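(* Let $m,n\ge 1$ be integers, and let $X_1,\ldots,X_m$ and $Y_1,\ldots,Y_n$ be independent random samples from absolutely continuous univariate distribution functions $F$ and $G$, respectively. Suppose the Lehmann alternative $H_{LE}$ holds: $G(x)=1-(1-F(x))^{1/\eta}$ for all $x$, for some $\eta>1$. Then for any integers $0\le s<m$ and $0\le r<n$, the joint probability mass function of $A_s$ and $B_r$ under $H_{LE}$ is given by $$P(A_s=k,\,B_r=i)=\frac{m!\,n!\,(1/\eta)}{r!\,s!\,(n-k-r-1)!\,k!}\,S_p\,S_z$$ for integers $0\le i\le m-s-1$ and $0\le k\le n-r-1$; $$P(A_s=k,\,B_r=i)=\frac{m!\,n!\,\eta}{(n-r-1)!\,(m-s-1)!\,(i-m+s)!\,(m-i)!}\,S_p'\,S_z'$$ for integers $m-s\le i\le m$ and $n-r\le k\le n$; and $P(A_s=k,\,B_r=i)=0$ otherwise, where $$S_p=\sum_{p=0}^{r}(-1)^p\binom{r}{p}\frac{\Gamma(m-i+(n-r+p)/\eta)}{\Gamma(m+(n-r+p)/\eta+1)},$$ $$S_z=\sum_{z=0}^{n-k-r-1}(-1)^z\binom{n-k-r-1}{z}\frac{\Gamma(s+(z+k)/\eta+1)}{\Gamma(m-i+(z+k)/\eta+1)},$$ $$S_p'=\sum_{p=0}^{i-m+s}(-1)^p\binom{i-m+s}{p}\frac{\Gamma(n-r+(m-i+p)\eta)}{\Gamma(k+(m-i+p)\eta+1)},$$ $$S_z'=\sum_{z=0}^{m-s-1}(-1)^z\binom{m-s-1}{z}\frac{\Gamm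a(k+(z+s+1)\eta)}{\Gamma(n+(z+s+1)\eta+1)}.$$
   Context: $X_{(1)}\le\dots\le X_{(m)}$ and $Y_{(1)}\le\dots\le Y_{(n)}$ denote the order statistics of the two samples. For $0\le s<m$ and $0\le r<n$, the exceedance statistic $A_s$ is the number of $Y$-observations larger than $X_{(m-s)}$, and the precedence statistic $B_r$ is the number of $X$-observations smaller than $Y_{(1+r)}$. The two samples are independent of each other and the observations within each sample are i.i.d. $\Gamma$ is the Gamma function. *)

theory Defs
  imports "HOL-Probability.Probability"
begin

definition abs_cont_cdf :: "(real \<Rightarrow> real) \<Rightarrow> bool" where
  "abs_cont_cdf F \<longleftrightarrow>
     (\<exists>f :: real \<Rightarrow> real. integrable lborel f \<and> (\<forall>t. 0 \<le> f t) \<and> (\<integral>t. f t \<partial>lborel) = 1 \<and>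
        (\<forall>x. F x = (LINT t:{..x}|lborel. f t)))"

(* Samples are indexed from 1: X 1, ..., X N. *)
definition iid_sample :: "'a measure \<Rightarrow> nat \<Rightarrow> (nat \<Rightarrow> 'a \<Rightarrow> real) \<Rightarrow> (real \<Rightarrow> real) \<Rightarrow> bool" where
  "iid_sample M N X F \<longleftrightarrow>
     prob_space.indep_vars M (\<lambda>_. borel) X {1..N} \<and>
     (\<forall>i\<in>{1..N}. cdf (distr M borel (X i)) = F)"

definition indep_samples ::
  "'a measure \<Rightarrow> nat \<Rightarrow> (nat \<Rightarrow> 'a \<Rightarrow> real) \<Rightarrow> nat \<Rightarrow> (nat \<Rightarrow> 'a \<Rightarrow> real) \<Rightarrow> bool" where
  "indep_samples M m X n Y \<longleftrightarrow>
     prob_space.indep_var M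
       (PiM {1..m} (\<lambda>_. borel)) (\<lambda>\<omega>. \<lambda>i\<in>{1..m}. X i \<omega>)
       (PiM {1..n} (\<lambda>_. borel)) (\<lambda>\<omega>. \<lambda>j\<in>{1..n}. Y j \<omega>)"

(* The j-th smallest of x 1, ..., x N, counted with multiplicity; meaningful for 1 \<le> j \<le> N. *)
definition order_stat :: "nat \<Rightarrow> (nat \<Rightarrow> real) \<Rightarrow> nat \<Rightarrow> real" where
  "order_stat N x j = sort (map x [1..<Suc N]) ! (j - 1)"

definition exceedance_stat ::
  "nat \<Rightarrow> nat \<Rightarrow> (nat \<Rightarrow> 'a \<Rightarrow> real) \<Rightarrow> (nat \<Rightarrow> 'a \<Rightarrow> real) \<Rightarrow> nat \<Rightarrow> 'a \<Rightarrow> nat" where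
  "exceedance_stat m n X Y s \<omega> =
     card {j\<in>{1..n}. Y j \<omega> > order_stat m (\<lambda>i. X i \<omega>) (m - s)}"

definition precedence_stat ::
  "nat \<Rightarrow> nat \<Rightarrow> (nat \<Rightarrow> 'a \<Rightarrow> real) \<Rightarrow> (nat \<Rightarrow> 'a \<Rightarrow> real) \<Rightarrow> nat \<Rightarrow> 'a \<Rightarrow> nat" where
  "precedence_stat m n X Y r \<omega> =
     card {i\<in>{1..m}. X i \<omega> < order_stat n (\<lambda>j. Y j \<omega>) (1 + r)}"

definition lehmann_alternative :: "real \<Rightarrow> (real \<Rightarrow> real) \<Rightarrow> (real \<Rightarrow> real) \<Rightarrow> bool" where
  "lehmann_alternative \<eta> F G \<longleftrightarrow> (\<forall>x. G x = 1 - (1 - F x) powr (1 / \<eta>))"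

(* S_p and S_z are used only for i \<le> m - s - 1 and k \<le> n - r - 1, S_p' and S_z' only for
   m - s \<le> i \<le> m and n - r \<le> k \<le> n, always with s < m and r < n; there no natural-number
   subtraction below is truncated. *)
definition S_p :: "nat \<Rightarrow> nat \<Rightarrow> nat \<Rightarrow> real \<Rightarrow> nat \<Rightarrow> real" where
  "S_p m n r \<eta> i =
     (\<Sum>p=0..r. (-1) ^ p * real (r choose p) *
        (Gamma (real (m - i) + real (n - r + p) / \<eta>) /
         Gamma (real m + real (n - r + p) / \<eta> + 1)))"

definition S_z :: "nat \<Rightarrow> nat \<Rightarrow> nat \<Rightarrow> nat \<Rightarrow> real \<Rightarrow> nat \<Rightarrow> nat \<Rightarrow> real" where
  "S_z m n s r \<eta> k i =
     (\<Sum>z=0..n - k - r - 1. (-1) ^ z * real ((n - k - r - 1) choose z) *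
        (Gamma (real s + real (z + k) / \<eta> + 1) /
         Gamma (real (m - i) + real (z + k) / \<eta> + 1)))"

definition S_p' :: "nat \<Rightarrow> nat \<Rightarrow> nat \<Rightarrow> nat \<Rightarrow> real \<Rightarrow> nat \<Rightarrow> nat \<Rightarrow> real" where
  "S_p' m n s r \<eta> k i =
     (\<Sum>p=0..i - (m - s). (-1) ^ p * real ((i - (m - s)) choose p) *
        (Gamma (real (n - r) + real (m - i + p) * \<eta>) /
         Gamma (real k + real (m - i + p) * \<eta> + 1)))"

definition S_z' :: "nat \<Rightarrow> nat \<Rightarrow> nat \<Rightarrow> real \<Rightarrow> nat \<Rightarrow> real" where
  "S_z' m n s \<eta> k =
     (\<Sum>z=0..m - s - 1. (-1) ^ z * real ((m - s - 1) choose z) *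
        (Gamma (real k + real (z + s + 1) * \<eta>) /
         Gamma (real n + real (z + s + 1) * \<eta> + 1)))"

end

theory Submission
  imports Defs
begin

text \<open>
Write \<open>x = X\<^sub>(\<^sub>m\<^sub>-\<^sub>s\<^sub>)\<close> and \<open>y = Y\<^sub>(\<^sub>1\<^sub>+\<^sub>r\<^sub>)\<close>. Counting alone shows that \<open>x < y\<close> holds iff
\<open>B\<^sub>r \<ge> m - s\<close>, and also iff \<open>A\<^sub>s \<ge> n - r\<close> (\<open>order_stats_separated_iff\<close>). So the two statistics
always lie in the same one of the two regimes of the formula, and every other pair of values has
probability zero.

Consider the regime \<open>y \<le> x\<close>. Both laws are continuous, so almost surely there are no ties, and
then exactly one pair \<open>(a, b)\<close> satisfies \<open>X a = x\<close> and \<open>Y b = y\<close>. The event that \<open>A\<^sub>s = k\<close> and \<open>B\<^sub>r = i\<close>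
becomes the disjoint union, over the \<open>m * n\<close> pairs, of the events \<open>separated_at\<close>: \<open>Y b < X a\<close>, and the
remaining \<open>X\<close>-values split as \<open>i\<close> below \<open>Y b\<close>, \<open>s\<close> above \<open>X a\<close> and the rest between, while the
remaining \<open>Y\<close>-values split as \<open>r\<close> below, \<open>k\<close> above and the rest between. Given the values of \<open>X a\<close>
and \<open>Y b\<close> the remaining observations are independent, so each sample contributes a trinomial
probability, and Fubini leaves a double integral over \<open>Y b\<close> and \<open>X a\<close>
(\<open>emeasure_separated_configuration\<close>).

Let \<open>u = 1 - F (Y b)\<close>, \<open>v = 1 - F (X a)\<close> and \<open>\<theta> = 1 / \<eta>\<close>. Under the alternative \<open>1 - G\<close> is the power
\<open>(1 - F) powr \<theta>\<close>, so the integrand depends on \<open>u\<close> and \<open>v\<close> only, where \<open>v\<close> and \<open>t = u powr \<theta>\<close> are uniform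
on the unit interval (\<open>nn_integral_survival\<close>). The substitution \<open>v = u * w\<close> separates the variables, since
\<open>u - v = u * (1 - w)\<close> and \<open>u powr \<theta> - v powr \<theta> = t * (1 - w powr \<theta>)\<close>. What remains is a product of two integrals of
the form \<open>\<integral> t powr c * (1 - t powr \<alpha>) ^ i * (1 - t powr \<beta>) ^ r\<close>. Expanding the last factor by the binomial
theorem turns each into an alternating sum of Gamma quotients
(\<open>has_integral_alternating_sum\<close>); these sums are \<open>S_p\<close> and \<open>S_z\<close>.

The regime \<open>x < y\<close> is the first one with the two samples exchanged and \<open>\<eta>\<close> replaced by \<open>1 / \<eta>\<close>:
without ties between the samples, \<open>n - A\<^sub>s\<close> counts the \<open>Y\<close>-values below \<open>X\<^sub>(\<^sub>m\<^sub>-\<^sub>s\<^sub>)\<close> and \<open>m - B\<^sub>r\<close> counts the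
\<open>X\<close>-values above \<open>Y\<^sub>(\<^sub>1\<^sub>+\<^sub>r\<^sub>)\<close>, which are a precedence and an exceedance statistic for the exchanged
samples (\<open>stats_complement\<close>).
\<close>

section \<open>Alternating Gamma sums as integrals over the unit interval\<close>

text \<open>
The substitution \<open>x = t powr \<eta>\<close> would reduce this to a Beta integral. Induction on \<open>i\<close> is more direct:
\<open>(1 - t powr \<eta>) ^ Suc i\<close> is \<open>(1 - t powr \<eta>) ^ i\<close> minus \<open>t powr \<eta>\<close> times the same power, and the second term shifts
\<open>(c + 1) / \<eta>\<close> by one, where the functional equation of the Gamma function applies.
\<close>

lemma has_integral_powr_one_minus_powr:
  fixes c \<eta> :: real
  assumes "c > -1" "\<eta> > 0"
  shows "((\<lambda>t. t powr c * (1 - t powr \<eta>) ^ i) has_integral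
           (fact i / \<eta> * (Gamma ((c + 1) / \<eta>) / Gamma ((c + 1) / \<eta> + real i + 1)))) {0..1}"
  using assms(1)
proof (induction i arbitrary: c)
  case 0
  have x: "(c + 1) / \<eta> > 0" using 0 assms by simp
  have "((\<lambda>t. t powr c) has_integral (1 powr (c + 1) / (c + 1))) {0..1}"
    using 0 by (intro has_integral_powr_from_0) auto
  moreover have "Gamma ((c + 1) / \<eta> + 1) = (c + 1) / \<eta> * Gamma ((c + 1) / \<eta>)"
    using x by (intro Gamma_plus1) (auto elim!: nonpos_Ints_cases)
  then have "Gamma ((c + 1) / \<eta>) / Gamma ((c + 1) / \<eta> + 1) = \<eta> / (c + 1)"
    using Gamma_real_pos[OF x] by simp
  ultimately show ?case using assms(2) by simp
next
  case (Suc i)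
  define x where "x = (c + 1) / \<eta>"
  have x: "x > 0" using Suc.prems assms by (simp add: x_def)
  have shift: "(c + \<eta> + 1) / \<eta> = x + 1" using assms by (simp add: x_def field_simps)
  have split: "t powr c * (1 - t powr \<eta>) ^ Suc i
      = t powr c * (1 - t powr \<eta>) ^ i - t powr (c + \<eta>) * (1 - t powr \<eta>) ^ i" for t :: real
    by (simp add: powr_add algebra_simps)
  have G1: "Gamma (x + 1) = x * Gamma x"
    using x by (intro Gamma_plus1) (auto elim!: nonpos_Ints_cases)
  have G2: "Gamma (x + real i + 1 + 1) = (x + real i + 1) * Gamma (x + real i + 1)"
    using x by (intro Gamma_plus1) (auto elim!: nonpos_Ints_cases)
  have pos: "Gamma (x + real i + 1) > 0" using x by (intro Gamma_real_pos) auto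
  have "((\<lambda>t. t powr c * (1 - t powr \<eta>) ^ Suc i) has_integral
      (fact i / \<eta> * (Gamma x / Gamma (x + real i + 1))
       - fact i / \<eta> * (Gamma (x + 1) / Gamma (x + 1 + real i + 1)))) {0..1}"
    unfolding split
    using Suc.IH[of c] Suc.IH[of "c + \<eta>"] Suc.prems assms unfolding shift x_def[symmetric]
    by (intro has_integral_diff) auto
  also have "fact i / \<eta> * (Gamma x / Gamma (x + real i + 1))
       - fact i / \<eta> * (Gamma (x + 1) / Gamma (x + 1 + real i + 1))
     = fact (Suc i) / \<eta> * (Gamma x / Gamma (x + real (Suc i) + 1))"
  proof -
    have e: "x + 1 + real i + 1 = x + real i + 1 + 1" "x + real (Suc i) + 1 = x + real i + 1 + 1"
      by simp_all
    show ?thesis unfolding e G1 G2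
      using pos x assms(2) by (simp add: divide_simps) (simp add: algebra_simps)
  qed
  finally show ?case unfolding x_def .
qed

lemma has_integral_alternating_sum:
  fixes c \<eta> \<theta> :: real
  assumes "c > -1" "\<eta> > 0" "\<theta> > 0"
  shows "((\<lambda>t. t powr c * (1 - t powr \<eta>) ^ i * (1 - t powr \<theta>) ^ r) has_integral
    (fact i / \<eta> * (\<Sum>p=0..r. (-1) ^ p * real (r choose p) *
       (Gamma ((c + real p * \<theta> + 1) / \<eta>) / Gamma ((c + real p * \<theta> + 1) / \<eta> + real i + 1))))) {0..1}"
proof -
  have "((\<lambda>t. \<Sum>p=0..r. (-1) ^ p * real (r choose p) *
          (t powr (c + real p * \<theta>) * (1 - t powr \<eta>) ^ i)) has_integral
     (\<Sum>p=0..r. (-1) ^ p * real (r choose p) * (fact i / \<eta> *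
       (Gamma ((c + real p * \<theta> + 1) / \<eta>) / Gamma ((c + real p * \<theta> + 1) / \<eta> + real i + 1))))) {0..1}"
    using assms
    by (intro has_integral_sum has_integral_mult_right has_integral_powr_one_minus_powr)
       (auto intro: less_le_trans)
  moreover have "(\<Sum>p=0..r. (-1) ^ p * real (r choose p) *
          (t powr (c + real p * \<theta>) * (1 - t powr \<eta>) ^ i))
      = t powr c * (1 - t powr \<eta>) ^ i * (1 - t powr \<theta>) ^ r" for t :: real
  proof (cases "t = 0")
    case False
    have "(1 - t powr \<theta>) ^ r = (- (t powr \<theta>) + 1) ^ r" by simp
    also have "\<dots> = (\<Sum>p\<le>r. of_nat (r choose p) * (- (t powr \<theta>)) ^ p * 1 ^ (r - p))"
      by (rule binomial_ring)
    also have "\<dots> = (\<Sum>p=0..r. (-1) ^ p * real (r choose p) * t powr (real p * \<theta>))"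
    proof (rule sum.cong)
      fix p
      have "t powr (real p * \<theta>) = (t powr \<theta>) ^ p"
        using False powr_realpow[of "t powr \<theta>" p] by (simp add: powr_powr ac_simps)
      then show "of_nat (r choose p) * (- (t powr \<theta>)) ^ p * 1 ^ (r - p)
          = (-1) ^ p * real (r choose p) * t powr (real p * \<theta>)"
        by (simp add: power_minus[of "t powr \<theta>"])
    qed auto
    finally show ?thesis
      by (simp add: sum_distrib_left sum_distrib_right powr_add mult_ac)
  qed simp
  ultimately show ?thesis by (simp add: sum_distrib_left mult_ac)
qed

text \<open>
The open interval matters: \<open>0 powr 0 = 0\<close>, so powers with natural and with real exponents agree only
away from the origin.
\<close>

lemma nn_integral_unit_interval:
  fixes f :: "real \<Rightarrow> real"
  assumes [measurable]: "f \<in> borel_measurable borel"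
    and nonneg: "\<And>t. 0 < t \<Longrightarrow> t < 1 \<Longrightarrow> 0 \<le> f t"
    and I: "(f has_integral I) {0..1}"
  shows "(\<integral>\<^sup>+t\<in>{0<..<1}. ennreal (f t) \<partial>lborel) = ennreal I"
proof -
  have "((\<lambda>t. if t \<in> {0<..<1} then f t else 0) has_integral I) UNIV"
    using I by (simp only: has_integral_Icc_iff_Ioo has_integral_restrict_UNIV)
  then have "(\<integral>\<^sup>+t. ennreal (if t \<in> {0<..<1} then f t else 0) \<partial>lborel) = ennreal I"
    using nonneg by (intro nn_integral_has_integral_lborel) auto
  also have "(\<integral>\<^sup>+t. ennreal (if t \<in> {0<..<1} then f t else 0) \<partial>lborel)
      = (\<integral>\<^sup>+t\<in>{0<..<1}. ennreal (f t) \<partial>lborel)"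
    by (intro nn_integral_cong) (simp split: split_indicator)
  finally show ?thesis by simp
qed

text \<open>
The value of the integral over \<open>t = u powr \<theta>\<close> that remains after the separation of variables: \<open>s + a + 1 = m - i\<close> and
\<open>k + b + 1 = n - r\<close> in the application, where \<open>a\<close> and \<open>b\<close> are the numbers of \<open>X\<close>- and \<open>Y\<close>-values that
fall strictly between the two marked observations.
\<close>

definition outer_value :: "nat \<Rightarrow> nat \<Rightarrow> nat \<Rightarrow> nat \<Rightarrow> nat \<Rightarrow> nat \<Rightarrow> real \<Rightarrow> real" where
  "outer_value i a s r b k \<theta> = fact i * \<theta> * (\<Sum>p=0..r. (-1) ^ p * real (r choose p) *
        (Gamma (real (s + a + 1) + real (k + b + 1 + p) * \<theta>) /
         Gamma (real (s + a + 1) + real (k + b + 1 + p) * \<theta> + real i + 1)))"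

text \<open>
The value of the integral over \<open>w = v / u\<close>, with \<open>a\<close> and \<open>b\<close> as in \<open>outer_value\<close>.
\<close>

definition inner_value :: "nat \<Rightarrow> nat \<Rightarrow> nat \<Rightarrow> nat \<Rightarrow> real \<Rightarrow> real" where
  "inner_value a s b k \<theta> = fact a * (\<Sum>z=0..b. (-1) ^ z * real (b choose z) *
        (Gamma (real s + real (z + k) * \<theta> + 1) /
         Gamma (real s + real (z + k) * \<theta> + 1 + real a + 1)))"

lemma has_integral_outer:
  assumes \<theta>: "\<theta> > 0"
  shows "((\<lambda>t. t powr (real (s + a + 1) / \<theta> + real (k + b)) * (1 - t powr (1 / \<theta>)) ^ i
      * (1 - t powr 1) ^ r) has_integral outer_value i a s r b k \<theta>) {0..1}"
proof -
  let ?c = "real (s + a + 1) / \<theta> + real (k + b)"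
  have e: "(?c + real p * 1 + 1) / (1 / \<theta>) = real (s + a + 1) + real (k + b + 1 + p) * \<theta>" for p
    using \<theta> by (simp add: field_simps)
  have "((\<lambda>t. t powr ?c * (1 - t powr (1 / \<theta>)) ^ i * (1 - t powr 1) ^ r) has_integral
      fact i / (1 / \<theta>) * (\<Sum>p=0..r. (-1) ^ p * real (r choose p) *
        (Gamma ((?c + real p * 1 + 1) / (1 / \<theta>)) /
         Gamma ((?c + real p * 1 + 1) / (1 / \<theta>) + real i + 1)))) {0..1}"
    using \<theta> by (intro has_integral_alternating_sum) (auto intro: less_le_trans[of _ 0])
  then show ?thesis unfolding e outer_value_def using \<theta> by simp
qed

lemma has_integral_inner:
  assumes \<theta>: "\<theta> > 0"
  shows "((\<lambda>w. w powr (real s + real k * \<theta>) * (1 - w powr 1) ^ a * (1 - w powr \<theta>) ^ b)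
      has_integral inner_value a s b k \<theta>) {0..1}"
proof -
  let ?c = "real s + real k * \<theta>"
  have e: "(?c + real z * \<theta> + 1) / 1 = real s + real (z + k) * \<theta> + 1" for z
    by (simp add: algebra_simps)
  have "((\<lambda>w. w powr ?c * (1 - w powr 1) ^ a * (1 - w powr \<theta>) ^ b) has_integral
      fact a / 1 * (\<Sum>z=0..b. (-1) ^ z * real (b choose z) *
        (Gamma ((?c + real z * \<theta> + 1) / 1) /
         Gamma ((?c + real z * \<theta> + 1) / 1 + real a + 1)))) {0..1}"
    using \<theta> by (intro has_integral_alternating_sum) (auto intro: less_le_trans[of _ 0])
  then show ?thesis unfolding e inner_value_def by simp
qed

lemma outer_value_nonneg: "\<theta> > 0 \<Longrightarrow> 0 \<le> outer_value i a s r b k \<theta>"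
  by (rule has_integral_nonneg[OF has_integral_outer])
     (auto intro!: mult_nonneg_nonneg zero_le_power simp: powr_le1)

lemma inner_value_nonneg: "\<theta> > 0 \<Longrightarrow> 0 \<le> inner_value a s b k \<theta>"
  by (rule has_integral_nonneg[OF has_integral_inner])
     (auto intro!: mult_nonneg_nonneg zero_le_power simp: powr_le1)

section \<open>The survival function of a continuous law\<close>

text \<open>
The probability integral transform: \<open>1 - cdf \<mu>\<close> is uniform on the unit interval under \<open>\<mu>\<close>. A law is the image of
the uniform law under the quantile function \<open>I\<close>, and continuity of the distribution function makes
\<open>I\<close> a right inverse of it.
\<close>

lemma nn_integral_survival:
  assumes "real_distribution \<mu>" and continuous_cdf: "\<And>x. isCont (cdf \<mu>) x"
    and [measurable]: "g \<in> borel_measurable borel"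
  shows "(\<integral>\<^sup>+x. g (1 - cdf \<mu> x) \<partial>\<mu>) = (\<integral>\<^sup>+u\<in>{0<..<1}. g u \<partial>lborel)"
proof -
  interpret cdf_distribution \<mu> using assms(1) by (simp add: cdf_distribution_def)
  have CI: "C (I \<omega>) = \<omega>" if \<omega>: "0 < \<omega>" "\<omega> < 1" for \<omega>
  proof (rule antisym)
    show "\<omega> \<le> C (I \<omega>)" using pseudoinverse[OF \<omega>, of "I \<omega>"] by simp
    have "(C \<longlongrightarrow> C (I \<omega>)) (at_left (I \<omega>))"
      using continuous_cdf[of "I \<omega>"] unfolding isCont_def filterlim_at_split by blast
    moreover have "\<forall>\<^sub>F x in at_left (I \<omega>). C x \<le> \<omega>"
      unfolding eventually_at_filter
      by (rule always_eventually) (metis lessThan_iff linorder_not_le order_less_imp_le pseudoinverse[OF \<omega>])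
    ultimately show "C (I \<omega>) \<le> \<omega>"
      by (rule tendsto_upperbound) simp
  qed
  have "(\<integral>\<^sup>+x. g (1 - C x) \<partial>\<mu>)
      = (\<integral>\<^sup>+x. g (1 - C x) \<partial>distr (restrict_space lborel {0<..<1::real}) borel I)"
    by (simp only: distr_I_eq_M)
  also have "\<dots> = (\<integral>\<^sup>+\<omega>. g (1 - C (I \<omega>)) \<partial>restrict_space lborel {0<..<1::real})"
    by (rule nn_integral_distr) (simp_all add: measurable_CI cong: measurable_cong_sets)
  also have "\<dots> = (\<integral>\<^sup>+\<omega>. g (1 - \<omega>) * indicator {0<..<1} \<omega> \<partial>lborel)"
    by (subst nn_integral_restrict_space)
       (auto intro!: nn_integral_cong simp: CI split: split_indicator)
  also have "\<dots> = (\<integral>\<^sup>+u\<in>{0<..<1}. g u \<partial>lborel)"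
    by (subst nn_integral_real_affine[where c="-1" and t=1])
       (auto intro!: nn_integral_cong split: split_indicator)
  finally show ?thesis .
qed

lemma measure_below_above:
  assumes "real_distribution \<mu>" and "\<And>x. isCont (cdf \<mu>) x"
  shows "measure \<mu> {..<y} = cdf \<mu> y" and "measure \<mu> {x<..} = 1 - cdf \<mu> x"
proof -
  interpret real_distribution \<mu> by fact
  have "measure \<mu> {y} = 0" using assms(2)[of y] isCont_cdf by blast
  moreover have "measure \<mu> {..y} = measure \<mu> {..<y} + measure \<mu> {y}"
    by (subst finite_measure_Union[symmetric]) (auto intro!: arg_cong[where f = "measure \<mu>"])
  ultimately show "measure \<mu> {..<y} = cdf \<mu> y" by (simp add: cdf_def)
  have "measure \<mu> (space \<mu> - {..x}) = 1 - measure \<mu> {..x}" by (intro prob_compl) auto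
  moreover have "space \<mu> - {..x} = {x<..}" by auto
  ultimately show "measure \<mu> {x<..} = 1 - cdf \<mu> x" by (simp add: cdf_def)
qed

section \<open>Order statistics and counting\<close>

text \<open>
In a sorted list the elements of a downward closed set form an initial segment.
\<close>

lemma sorted_nth_downward_closed:
  fixes zs :: "'a::linorder list"
  assumes "sorted zs" and "\<And>u v. u \<le> v \<Longrightarrow> P v \<Longrightarrow> P u" and "k < length zs"
  shows "P (zs ! k) \<longleftrightarrow> k < length (filter P zs)"
  using assms(1,3)
proof (induction zs arbitrary: k)
  case (Cons z zs)
  show ?case
  proof (cases "P z")
    case True
    then show ?thesis using Cons by (cases k) auto
  next
    case False
    then have none: "\<not> P u" if "u \<in> set (z # zs)" for u
      using that Cons.prems(1) assms(2)[of z u] by auto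
    then have "filter P (z # zs) = []" by (simp add: filter_empty_conv)
    then show ?thesis using none[OF nth_mem[OF Cons.prems(2)]] by simp
  qed
qed simp

text \<open>
This converts every comparison with an order statistic into a count of observations, ties included,
so that the sorted list never has to be mentioned again.
\<close>

lemma order_stat_downward_closed:
  assumes "\<And>u v. u \<le> v \<Longrightarrow> P v \<Longrightarrow> P u" and "1 \<le> j" "j \<le> N"
  shows "P (order_stat N x j) \<longleftrightarrow> j \<le> card {l\<in>{1..N}. P (x l)}"
proof -
  let ?zs = "sort (map x [1..<Suc N])"
  have "length (filter P ?zs) = size (filter_mset P (mset ?zs))"
    by (metis mset_filter size_mset)
  also have "\<dots> = length (filter P (map x [1..<Suc N]))"
    by (metis mset_filter mset_sort size_mset)
  also have "\<dots> = length (filter (\<lambda>l. P (x l)) [1..<Suc N])"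
    by (simp add: filter_map comp_def del: upt_Suc)
  also have "\<dots> = card (set (filter (\<lambda>l. P (x l)) [1..<Suc N]))"
    by (intro distinct_card[symmetric] distinct_filter distinct_upt)
  also have "set (filter (\<lambda>l. P (x l)) [1..<Suc N]) = {l\<in>{1..N}. P (x l)}" by auto
  finally have len: "length (filter P ?zs) = card {l\<in>{1..N}. P (x l)}" .
  have "P (?zs ! (j - 1)) \<longleftrightarrow> j - 1 < length (filter P ?zs)"
    using assms by (intro sorted_nth_downward_closed) auto
  then show ?thesis using assms(2) unfolding order_stat_def len by auto
qed

lemma order_stat_less_iff:
  "1 \<le> j \<Longrightarrow> j \<le> N \<Longrightarrow> order_stat N x j < c \<longleftrightarrow> j \<le> card {l\<in>{1..N}. x l < c}"
  by (rule order_stat_downward_closed) auto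

lemma order_stat_le_iff:
  "1 \<le> j \<Longrightarrow> j \<le> N \<Longrightarrow> order_stat N x j \<le> c \<longleftrightarrow> j \<le> card {l\<in>{1..N}. x l \<le> c}"
  by (rule order_stat_downward_closed) auto

lemma order_stat_attained:
  assumes "1 \<le> j" "j \<le> N"
  shows "\<exists>a\<in>{1..N}. order_stat N x j = x a"
proof -
  have "order_stat N x j \<in> set (sort (map x [1..<Suc N]))"
    unfolding order_stat_def using assms by (intro nth_mem) auto
  then show ?thesis by (auto simp: less_Suc_eq_le)
qed

lemma order_stat_eq_iff:
  assumes inj: "inj_on x {1..N}" and "1 \<le> j" "j \<le> N" and a: "a \<in> {1..N}"
  shows "order_stat N x j = x a \<longleftrightarrow> card {l\<in>{1..N}. x l < x a} = j - 1"
proof -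
  have "l = a" if "l \<in> {1..N}" "x l = x a" for l
    using inj_onD[OF inj] that a by blast
  then have "{l\<in>{1..N}. x l \<le> x a} = insert a {l\<in>{1..N}. x l < x a}"
    using a unfolding le_less by blast
  then have "card {l\<in>{1..N}. x l \<le> x a} = Suc (card {l\<in>{1..N}. x l < x a})" by simp
  moreover have "order_stat N x j = x a \<longleftrightarrow> order_stat N x j \<le> x a \<and> \<not> order_stat N x j < x a"
    by auto
  ultimately show ?thesis
    unfolding order_stat_less_iff[OF assms(2,3)] order_stat_le_iff[OF assms(2,3)]
    using assms(2) by linarith
qed

text \<open>
The reason why the two statistics determine the same regime. It is a pure counting fact and holds in the
presence of ties as well.
\<close>

lemma order_stats_separated_iff:
  assumes "s < m" "r < n"
  shows "order_stat m x (m - s) < order_stat n y (1 + r) \<longleftrightarrow>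
           m - s \<le> card {i\<in>{1..m}. x i < order_stat n y (1 + r)}"
    and "order_stat m x (m - s) < order_stat n y (1 + r) \<longleftrightarrow>
           n - r \<le> card {j\<in>{1..n}. order_stat m x (m - s) < y j}"
proof -
  show "order_stat m x (m - s) < order_stat n y (1 + r) \<longleftrightarrow>
           m - s \<le> card {i\<in>{1..m}. x i < order_stat n y (1 + r)}"
    using assms by (intro order_stat_less_iff) auto
  have "card {1..n} = card ({j\<in>{1..n}. y j \<le> order_stat m x (m - s)} \<union> {j\<in>{1..n}. order_stat m x (m - s) < y j})"
    by (rule arg_cong[where f = card]) auto
  also have "card ({j\<in>{1..n}. y j \<le> order_stat m x (m - s)} \<union> {j\<in>{1..n}. order_stat m x (m - s) < y j})
     = card {j\<in>{1..n}. y j \<le> order_stat m x (m - s)} + card {j\<in>{1..n}. order_stat m x (m - s) < y j}"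
    by (intro card_Un_disjoint) auto
  finally have "card {j\<in>{1..n}. y j \<le> order_stat m x (m - s)}
      + card {j\<in>{1..n}. order_stat m x (m - s) < y j} = n"
    by simp
  moreover have "order_stat n y (1 + r) \<le> order_stat m x (m - s) \<longleftrightarrow>
      1 + r \<le> card {j\<in>{1..n}. y j \<le> order_stat m x (m - s)}"
    using assms by (intro order_stat_le_iff) auto
  ultimately show "order_stat m x (m - s) < order_stat n y (1 + r) \<longleftrightarrow>
           n - r \<le> card {j\<in>{1..n}. order_stat m x (m - s) < y j}"
    using \<open>r < n\<close> by linarith
qed

text \<open>
The observations \<open>x a\<close> and \<open>y b\<close> are left out of the counts, so that for fixed values of these two the
condition constrains the other coordinates independently.
\<close>

definition separated_at ::
    "nat \<Rightarrow> nat \<Rightarrow> nat \<Rightarrow> nat \<Rightarrow> nat \<Rightarrow> nat \<Rightarrow> (nat \<Rightarrow> real) \<Rightarrow> (nat \<Rightarrow> real) \<Rightarrow> nat \<Rightarrow> nat \<Rightarrow> bool" where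
  "separated_at m n i s r k x y a b \<longleftrightarrow> y b < x a
     \<and> card {j\<in>{1..m} - {a}. x j < y b} = i \<and> card {j\<in>{1..m} - {a}. x a < x j} = s
     \<and> card {j\<in>{1..n} - {b}. y j < y b} = r \<and> card {j\<in>{1..n} - {b}. x a < y j} = k"

lemma card_less_greater:
  fixes x :: "nat \<Rightarrow> real"
  assumes inj: "inj_on x {1..N}" and a: "a \<in> {1..N}"
  shows "card {j\<in>{1..N}. x j < x a} + card {j\<in>{1..N}. x a < x j} + 1 = N"
proof -
  have "x j < x a \<or> x a < x j" if "j \<in> {1..N}" "j \<noteq> a" for j
    using inj_onD[OF inj _ that(1) a] that(2) by (meson neq_iff)
  then have "{1..N} = insert a ({j\<in>{1..N}. x j < x a} \<union> {j\<in>{1..N}. x a < x j})"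
    using a by blast
  then have "card {1..N} = card (insert a ({j\<in>{1..N}. x j < x a} \<union> {j\<in>{1..N}. x a < x j}))"
    by (rule arg_cong)
  also have "card (insert a ({j\<in>{1..N}. x j < x a} \<union> {j\<in>{1..N}. x a < x j}))
      = card {j\<in>{1..N}. x j < x a} + card {j\<in>{1..N}. x a < x j} + 1"
    by (simp add: card_Un_disjoint disjoint_iff)
  finally show ?thesis by simp
qed

text \<open>
Without ties \<open>x a\<close> has rank \<open>m - s\<close> iff exactly \<open>s\<close> of the other values exceed it, and the marked
observations themselves do not contribute to the two statistics because \<open>y b < x a\<close>.
\<close>

lemma separated_at_iff:
  assumes inj: "inj_on x {1..m}" "inj_on y {1..n}" and "s < m" "r < n"
    and a: "a \<in> {1..m}" and b: "b \<in> {1..n}"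
  shows "separated_at m n i s r k x y a b \<longleftrightarrow>
    order_stat m x (m - s) = x a \<and> order_stat n y (1 + r) = y b \<and> y b < x a
     \<and> card {j\<in>{1..m}. x j < y b} = i \<and> card {j\<in>{1..n}. x a < y j} = k"
proof -
  have "order_stat m x (m - s) = x a \<longleftrightarrow> card {j\<in>{1..m}. x j < x a} = m - s - 1"
    using \<open>s < m\<close> by (intro order_stat_eq_iff inj a) auto
  also have "\<dots> \<longleftrightarrow> card {j\<in>{1..m}. x a < x j} = s"
    using card_less_greater[OF inj(1) a] \<open>s < m\<close> by linarith
  also have "{j\<in>{1..m}. x a < x j} = {j\<in>{1..m} - {a}. x a < x j}" by auto
  finally have 1: "order_stat m x (m - s) = x a \<longleftrightarrow> card {j\<in>{1..m} - {a}. x a < x j} = s" .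
  have "order_stat n y (1 + r) = y b \<longleftrightarrow> card {j\<in>{1..n}. y j < y b} = (1 + r) - 1"
    using \<open>r < n\<close> by (intro order_stat_eq_iff inj b) auto
  also have "{j\<in>{1..n}. y j < y b} = {j\<in>{1..n} - {b}. y j < y b}" by auto
  finally have 2: "order_stat n y (1 + r) = y b \<longleftrightarrow> card {j\<in>{1..n} - {b}. y j < y b} = r" by simp
  have 3: "{j\<in>{1..m} - {a}. x j < y b} = {j\<in>{1..m}. x j < y b}"
      "{j\<in>{1..n} - {b}. x a < y j} = {j\<in>{1..n}. x a < y j}" if "y b < x a"
    using that by auto
  show ?thesis
  proof (cases "y b < x a")
    case True
    show ?thesis unfolding separated_at_def 1 2 3[OF True] by blast
  qed (simp add: separated_at_def)
qed

text \<open>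
The hypothesis \<open>i < m - s\<close> selects the regime \<open>y b \<le> x a\<close>, and the absence of ties between the samples
makes the inequality strict.
\<close>

lemma stats_eq_iff_ex_separated_at:
  assumes inj: "inj_on x {1..m}" "inj_on y {1..n}" and cross: "\<And>a b. a \<in> {1..m} \<Longrightarrow> b \<in> {1..n} \<Longrightarrow> x a \<noteq> y b"
    and s: "s < m" and r: "r < n" and i: "i < m - s"
  shows "card {j\<in>{1..n}. order_stat m x (m - s) < y j} = k \<and> card {j\<in>{1..m}. x j < order_stat n y (1 + r)} = i
    \<longleftrightarrow> (\<exists>a\<in>{1..m}. \<exists>b\<in>{1..n}. separated_at m n i s r k x y a b)" (is "?L \<longleftrightarrow> ?R")
proof
  assume L: ?L
  obtain a where a: "a \<in> {1..m}" "order_stat m x (m - s) = x a"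
    using order_stat_attained[of "m - s" m x] s by (auto simp: Suc_le_eq)
  obtain b where b: "b \<in> {1..n}" "order_stat n y (1 + r) = y b"
    using order_stat_attained[of "1 + r" n y] r by (auto simp: Suc_le_eq)
  have "\<not> x a < y b"
    using order_stats_separated_iff(1)[OF s r, of x y] L i a(2) b(2) by simp
  then have "y b < x a" using cross[OF a(1) b(1)] by simp
  then have "separated_at m n i s r k x y a b"
    using L a b by (subst separated_at_iff[OF inj s r]) auto
  then show ?R using a b by blast
next
  assume ?R
  then obtain a b where ab: "a \<in> {1..m}" "b \<in> {1..n}" "separated_at m n i s r k x y a b" by blast
  then show ?L using separated_at_iff[OF inj s r ab(1,2)] by simp
qed

lemma separated_at_unique:
  assumes inj: "inj_on x {1..m}" "inj_on y {1..n}" and s: "s < m" and r: "r < n"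
    and ab: "a \<in> {1..m}" "b \<in> {1..n}" "a' \<in> {1..m}" "b' \<in> {1..n}"
    and "separated_at m n i s r k x y a b" "separated_at m n i s r k x y a' b'"
  shows "a = a' \<and> b = b'"
proof -
  have "x a = x a'" "y b = y b'"
    using assms(9,10) separated_at_iff[OF inj s r ab(1,2)] separated_at_iff[OF inj s r ab(3,4)] by auto
  then show ?thesis using inj_onD[OF inj(1)] inj_onD[OF inj(2)] ab by auto
qed

text \<open>
The choice of a marked observation together with the split of the other \<open>N - 1\<close>.
\<close>

lemma multinomial_count:
  assumes "p + q < N"
  shows "real N * (real (N - 1 choose p) * real (N - 1 - p choose q))
      = fact N / (fact p * fact q * fact (N - 1 - p - q))"
proof -
  have "real (N - 1 choose p) = fact (N - 1) / (fact p * fact (N - 1 - p))"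
    using assms by (intro binomial_fact) auto
  moreover have "real (N - 1 - p choose q) = fact (N - 1 - p) / (fact q * fact (N - 1 - p - q))"
    using assms by (intro binomial_fact) auto
  moreover have "fact N = real N * fact (N - 1)" using assms by (intro fact_reduce) auto
  ultimately show ?thesis by (simp add: field_simps)
qed

section \<open>The probability of a separated configuration\<close>

lemma measurable_card_Collect:
  fixes I :: "nat set"
  assumes "\<And>j. j \<in> I \<Longrightarrow> Measurable.pred M (P j)"
  shows "(\<lambda>\<omega>. card {j\<in>I. P j \<omega>}) \<in> measurable M (count_space UNIV)"
proof (rule measurable_card)
  fix j show "{\<omega> \<in> space M. j \<in> {j\<in>I. P j \<omega>}} \<in> sets M"
    using assms[of j] by (cases "j \<in> I") (auto simp: pred_def)
qed

text \<open>
The trinomial distribution. The event splits according to the set \<open>L\<close> of coordinates in \<open>A\<close> and the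
set \<open>U\<close> of coordinates in \<open>B\<close>; each pair \<open>(L, U)\<close> gives a box, whose measure is a product.
\<close>

lemma measure_PiM_two_counts:
  fixes \<mu> :: "'a measure" and I :: "'i set"
  assumes "prob_space \<mu>" and "finite I"
    and A [measurable]: "A \<in> sets \<mu>" and B [measurable]: "B \<in> sets \<mu>" and AB: "A \<inter> B = {}"
  shows "measure (PiM I (\<lambda>_. \<mu>))
      {x \<in> space (PiM I (\<lambda>_. \<mu>)). card {j\<in>I. x j \<in> A} = p \<and> card {j\<in>I. x j \<in> B} = q}
    = real (card I choose p) * real ((card I - p) choose q) *
        (measure \<mu> A ^ p * measure \<mu> B ^ q * (1 - measure \<mu> A - measure \<mu> B) ^ (card I - p - q))"
proof -
  interpret \<mu>: prob_space \<mu> by fact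
  interpret P: finite_product_prob_space "\<lambda>_. \<mu>" I by standard fact
  let ?P = "PiM I (\<lambda>_. \<mu>)"
  define C where "C = space \<mu> - A - B"
  have C [measurable]: "C \<in> sets \<mu>" by (simp add: C_def)
  have mC: "measure \<mu> C = 1 - measure \<mu> A - measure \<mu> B"
  proof -
    have "measure \<mu> (A \<union> B) = measure \<mu> A + measure \<mu> B"
      using AB by (intro \<mu>.finite_measure_Union) auto
    moreover have "measure \<mu> (space \<mu> - (A \<union> B)) = 1 - measure \<mu> (A \<union> B)"
      by (intro \<mu>.prob_compl) auto
    moreover have "C = space \<mu> - (A \<union> B)" by (auto simp: C_def)
    ultimately show ?thesis by simp
  qed
  define K where "K = (SIGMA L:{L. L \<subseteq> I \<and> card L = p}. {U. U \<subseteq> I - L \<and> card U = q})"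
  define side where "side LU j = (if j \<in> fst LU then A else if j \<in> snd LU then B else C)"
    for LU :: "'i set \<times> 'i set" and j
  have finK: "finite K"
    unfolding K_def using \<open>finite I\<close> by (intro finite_SigmaI) auto
  have cardK: "card K = (card I choose p) * ((card I - p) choose q)"
  proof -
    have "card {U. U \<subseteq> I - L \<and> card U = q} = (card I - p) choose q"
      if "L \<in> {L. L \<subseteq> I \<and> card L = p}" for L
      using that \<open>finite I\<close> n_subsets[of "I - L" q] finite_subset[of L I]
      by (simp add: card_Diff_subset)
    then show ?thesis
      unfolding K_def using \<open>finite I\<close> n_subsets[OF \<open>finite I\<close>, of p]
      by (subst card_SigmaI) auto
  qed
  have one: "measure ?P (Pi\<^sub>E I (side LU))
      = measure \<mu> A ^ p * measure \<mu> B ^ q * measure \<mu> C ^ (card I - p - q)" if LU: "LU \<in> K" for LU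
  proof -
    obtain L U where eq: "LU = (L, U)" by (cases LU)
    have L: "L \<subseteq> I" "card L = p" and U: "U \<subseteq> I - L" "card U = q"
      using LU by (auto simp: K_def eq)
    have fin: "finite L" "finite U" using L U \<open>finite I\<close> by (auto intro: finite_subset)
    have "measure ?P (Pi\<^sub>E I (side LU)) = (\<Prod>j\<in>I. measure \<mu> (side LU j))"
      by (intro P.prob_times) (auto simp: side_def)
    also have "\<dots> = (\<Prod>j\<in>L \<union> (U \<union> (I - L - U)). measure \<mu> (side LU j))"
      using L U by (intro prod.cong) auto
    also have "\<dots> = (\<Prod>j\<in>L. measure \<mu> (side LU j)) * ((\<Prod>j\<in>U. measure \<mu> (side LU j)) *
           (\<Prod>j\<in>I - L - U. measure \<mu> (side LU j)))"
      using U fin \<open>finite I\<close> by (subst prod.union_disjoint; (subst prod.union_disjoint)?) auto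
    also have "(\<Prod>j\<in>L. measure \<mu> (side LU j)) = measure \<mu> A ^ p"
      using L by (simp add: side_def eq)
    also have "(\<Prod>j\<in>U. measure \<mu> (side LU j)) = (\<Prod>j\<in>U. measure \<mu> B)"
      using U by (intro prod.cong) (auto simp: side_def eq)
    also have "(\<Prod>j\<in>I - L - U. measure \<mu> (side LU j)) = (\<Prod>j\<in>I - L - U. measure \<mu> C)"
      by (intro prod.cong) (auto simp: side_def eq)
    also have "card (I - L - U) = card I - p - q"
      using L U fin by (subst card_Diff_subset; (subst card_Diff_subset)?) auto
    then have "(\<Prod>j\<in>I - L - U. measure \<mu> C) = measure \<mu> C ^ (card I - p - q)" by simp
    finally show ?thesis using U by (simp add: mult.assoc)
  qed
  have recover: "fst W = {j\<in>I. x j \<in> A} \<and> snd W = {j\<in>I. x j \<in> B}"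
    if W: "W \<in> K" and x: "x \<in> Pi\<^sub>E I (side W)" for W x
  proof -
    have sub: "fst W \<subseteq> I" "snd W \<subseteq> I - fst W" using W by (auto simp: K_def)
    have "(x j \<in> A \<longleftrightarrow> j \<in> fst W) \<and> (x j \<in> B \<longleftrightarrow> j \<in> snd W)" if "j \<in> I" for j
    proof -
      have "x j \<in> side W j" using x that by (rule PiE_mem)
      moreover have "A \<inter> C = {}" "B \<inter> C = {}" by (auto simp: C_def)
      moreover have "j \<notin> fst W \<or> j \<notin> snd W" using sub by blast
      ultimately show ?thesis
        using AB unfolding side_def by (cases "j \<in> fst W"; cases "j \<in> snd W"; simp; blast)
    qed
    then show ?thesis using sub by blast
  qed
  have side_space: "side W j \<subseteq> space \<mu>" for W j
    using sets.sets_into_space[OF A] sets.sets_into_space[OF B] by (auto simp: side_def C_def)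
  have union: "{x \<in> space ?P. card {j\<in>I. x j \<in> A} = p \<and> card {j\<in>I. x j \<in> B} = q}
      = (\<Union>LU\<in>K. Pi\<^sub>E I (side LU))"
  proof (intro equalityI subsetI)
    fix x assume x: "x \<in> {x \<in> space ?P. card {j\<in>I. x j \<in> A} = p \<and> card {j\<in>I. x j \<in> B} = q}"
    then have "({j\<in>I. x j \<in> A}, {j\<in>I. x j \<in> B}) \<in> K" using AB by (auto simp: K_def)
    moreover have "x \<in> Pi\<^sub>E I (side ({j\<in>I. x j \<in> A}, {j\<in>I. x j \<in> B}))"
      using x by (auto simp: side_def C_def space_PiM PiE_iff)
    ultimately show "x \<in> (\<Union>LU\<in>K. Pi\<^sub>E I (side LU))" by blast
  next
    fix x assume "x \<in> (\<Union>LU\<in>K. Pi\<^sub>E I (side LU))"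
    then obtain W where W: "W \<in> K" and x: "x \<in> Pi\<^sub>E I (side W)" by auto
    have "card (fst W) = p" "card (snd W) = q" using W by (auto simp: K_def)
    moreover have "x \<in> space ?P"
      using subsetD[OF PiE_mono x, of "\<lambda>_. space \<mu>"] side_space by (simp add: space_PiM)
    ultimately show "x \<in> {x \<in> space ?P. card {j\<in>I. x j \<in> A} = p \<and> card {j\<in>I. x j \<in> B} = q}"
      using recover[OF W x] by simp
  qed
  have disj: "disjoint_family_on (\<lambda>LU. Pi\<^sub>E I (side LU)) K"
    unfolding disjoint_family_on_def
  proof (intro ballI impI)
    fix V W assume "V \<in> K" "W \<in> K" "V \<noteq> W"
    then have False if "x \<in> Pi\<^sub>E I (side V)" "x \<in> Pi\<^sub>E I (side W)" for x
      using recover[OF \<open>V \<in> K\<close> that(1)] recover[OF \<open>W \<in> K\<close> that(2)] by (simp add: prod_eq_iff)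
    then show "Pi\<^sub>E I (side V) \<inter> Pi\<^sub>E I (side W) = {}" by blast
  qed
  have "measure ?P (\<Union>LU\<in>K. Pi\<^sub>E I (side LU)) = (\<Sum>LU\<in>K. measure ?P (Pi\<^sub>E I (side LU)))"
    using finK disj
    by (intro P.finite_measure_finite_Union) (auto intro!: sets_PiM_I_finite \<open>finite I\<close> simp: side_def)
  also have "\<dots> = real (card K) *
      (measure \<mu> A ^ p * measure \<mu> B ^ q * measure \<mu> C ^ (card I - p - q))"
    by (simp add: one)
  finally show ?thesis unfolding union by (simp add: cardK mC)
qed

text \<open>
Fubini, in the order that conditions on one marked coordinate in each factor.
\<close>

lemma nn_integral_pair_PiM_single_out:
  assumes "prob_space \<mu>" and "prob_space \<nu>"
    and I: "finite I" "a \<notin> I" and J: "finite J" "b \<notin> J"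
    and f [measurable]:
      "f \<in> borel_measurable (PiM (insert a I) (\<lambda>_. \<mu>) \<Otimes>\<^sub>M PiM (insert b J) (\<lambda>_. \<nu>))"
  shows "(\<integral>\<^sup>+z. f z \<partial>(PiM (insert a I) (\<lambda>_. \<mu>) \<Otimes>\<^sub>M PiM (insert b J) (\<lambda>_. \<nu>)))
    = (\<integral>\<^sup>+\<eta>. \<integral>\<^sup>+\<xi>. \<integral>\<^sup>+x. \<integral>\<^sup>+y. f (x(a := \<xi>), y(b := \<eta>))
         \<partial>PiM J (\<lambda>_. \<nu>) \<partial>PiM I (\<lambda>_. \<mu>) \<partial>\<mu> \<partial>\<nu>)"
proof -
  interpret \<mu>: prob_space \<mu> by fact
  interpret \<nu>: prob_space \<nu> by fact
  interpret PI: product_prob_space "\<lambda>_. \<mu>" UNIV by standard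
  interpret PJ: product_prob_space "\<lambda>_. \<nu>" UNIV by standard
  let ?PI = "PiM I (\<lambda>_. \<mu>)" and ?PJ = "PiM J (\<lambda>_. \<nu>)"
  let ?PaI = "PiM (insert a I) (\<lambda>_. \<mu>)" and ?PbJ = "PiM (insert b J) (\<lambda>_. \<nu>)"
  interpret FI: prob_space ?PI by (intro prob_space_PiM) (rule assms(1))
  interpret FJ: prob_space ?PJ by (intro prob_space_PiM) (rule assms(2))
  interpret FaI: prob_space ?PaI by (intro prob_space_PiM) (rule assms(1))
  interpret FbJ: prob_space ?PbJ by (intro prob_space_PiM) (rule assms(2))
  interpret P1: pair_sigma_finite ?PaI ?PbJ ..
  interpret P2: pair_sigma_finite ?PJ \<mu> ..
  interpret P3: pair_sigma_finite ?PJ ?PI ..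
  have "(\<integral>\<^sup>+z. f z \<partial>(?PaI \<Otimes>\<^sub>M ?PbJ)) = (\<integral>\<^sup>+y. \<integral>\<^sup>+x. f (x, y) \<partial>?PaI \<partial>?PbJ)"
    by (rule P1.nn_integral_snd[symmetric]) measurable
  also have "\<dots> = (\<integral>\<^sup>+\<eta>. \<integral>\<^sup>+y. \<integral>\<^sup>+x. f (x, y(b := \<eta>)) \<partial>?PaI \<partial>?PJ \<partial>\<nu>)"
    by (rule PJ.product_nn_integral_insert_rev[OF J]) measurable
  also have "\<dots> = (\<integral>\<^sup>+\<eta>. \<integral>\<^sup>+\<xi>. \<integral>\<^sup>+x. \<integral>\<^sup>+y. f (x(a := \<xi>), y(b := \<eta>)) \<partial>?PJ \<partial>?PI \<partial>\<mu> \<partial>\<nu>)"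
  proof (rule nn_integral_cong)
    fix \<eta> assume [measurable]: "\<eta> \<in> space \<nu>"
    have [measurable]: "(\<lambda>y. y(b := \<eta>)) \<in> measurable ?PJ ?PbJ"
      by (rule measurable_fun_upd[where J = J]) auto
    have "(\<integral>\<^sup>+y. \<integral>\<^sup>+x. f (x, y(b := \<eta>)) \<partial>?PaI \<partial>?PJ)
        = (\<integral>\<^sup>+y. \<integral>\<^sup>+\<xi>. \<integral>\<^sup>+x. f (x(a := \<xi>), y(b := \<eta>)) \<partial>?PI \<partial>\<mu> \<partial>?PJ)"
      by (intro nn_integral_cong PI.product_nn_integral_insert_rev[OF I]) measurable
    also have "\<dots> = (\<integral>\<^sup>+\<xi>. \<integral>\<^sup>+y. \<integral>\<^sup>+x. f (x(a := \<xi>), y(b := \<eta>)) \<partial>?PI \<partial>?PJ \<partial>\<mu>)"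
      by (rule P2.Fubini'[symmetric]) measurable
    also have "\<dots> = (\<integral>\<^sup>+\<xi>. \<integral>\<^sup>+x. \<integral>\<^sup>+y. f (x(a := \<xi>), y(b := \<eta>)) \<partial>?PJ \<partial>?PI \<partial>\<mu>)"
    proof (rule nn_integral_cong)
      fix \<xi> assume [measurable]: "\<xi> \<in> space \<mu>"
      show "(\<integral>\<^sup>+y. \<integral>\<^sup>+x. f (x(a := \<xi>), y(b := \<eta>)) \<partial>?PI \<partial>?PJ)
          = (\<integral>\<^sup>+x. \<integral>\<^sup>+y. f (x(a := \<xi>), y(b := \<eta>)) \<partial>?PJ \<partial>?PI)"
        by (rule P3.Fubini'[symmetric]) measurable
    qed
    finally show "(\<integral>\<^sup>+y. \<integral>\<^sup>+x. f (x, y(b := \<eta>)) \<partial>?PaI \<partial>?PJ)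
        = (\<integral>\<^sup>+\<xi>. \<integral>\<^sup>+x. \<integral>\<^sup>+y. f (x(a := \<xi>), y(b := \<eta>)) \<partial>?PJ \<partial>?PI \<partial>\<mu>)" .
  qed
  finally show ?thesis .
qed

text \<open>
The parameters \<open>u\<close> and \<open>v\<close> are values of the survival function at the lower and at the upper threshold.
\<close>

definition trinomial :: "nat \<Rightarrow> nat \<Rightarrow> nat \<Rightarrow> real \<Rightarrow> real \<Rightarrow> real" where
  "trinomial N p q u v =
     real (N choose p) * real ((N - p) choose q) * ((1 - u) ^ p * v ^ q * (u - v) ^ (N - p - q))"

text \<open>
For fixed values \<open>\<xi>\<close> and \<open>\<eta>\<close> of the marked coordinates the event is a product of an event \<open>C\<close> of the
other \<open>\<mu>\<close>-coordinates and an event \<open>D\<close> of the other \<open>\<nu>\<close>-coordinates, both with trinomial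
probability.
\<close>

lemma emeasure_separated_configuration:
  fixes I J :: "nat set" and i s r k :: nat
  assumes \<mu>: "real_distribution \<mu>" "\<And>x. isCont (cdf \<mu>) x"
    and \<nu>: "real_distribution \<nu>" "\<And>x. isCont (cdf \<nu>) x"
    and I: "finite I" "a \<notin> I" and J: "finite J" "b \<notin> J"
  defines "PQ \<equiv> PiM (insert a I) (\<lambda>_. \<mu>) \<Otimes>\<^sub>M PiM (insert b J) (\<lambda>_. \<nu>)"
  defines "E \<equiv> {z \<in> space PQ. snd z b < fst z a
        \<and> card {j\<in>I. fst z j < snd z b} = i \<and> card {j\<in>I. fst z a < fst z j} = s
        \<and> card {j\<in>J. snd z j < snd z b} = r \<and> card {j\<in>J. fst z a < snd z j} = k}"
  shows "E \<in> sets PQ" and "emeasure PQ E = (\<integral>\<^sup>+\<eta>. \<integral>\<^sup>+\<xi>. indicator {\<eta><..} \<xi> *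
         ennreal (trinomial (card I) i s (1 - cdf \<mu> \<eta>) (1 - cdf \<mu> \<xi>) *
                  trinomial (card J) r k (1 - cdf \<nu> \<eta>) (1 - cdf \<nu> \<xi>)) \<partial>\<mu> \<partial>\<nu>)"
proof -
  interpret \<mu>: real_distribution \<mu> by fact
  interpret \<nu>: real_distribution \<nu> by fact
  note measurable_card_Collect [measurable (raw)]
  have [measurable]: "(\<lambda>z. fst z j) \<in> borel_measurable PQ" if "j = a \<or> j \<in> I" for j
  proof -
    have "(\<lambda>z. fst z j) \<in> measurable PQ \<mu>"
      unfolding PQ_def using that
      by (intro measurable_compose[OF measurable_fst measurable_component_singleton]) auto
    then show ?thesis by (simp cong: measurable_cong_sets)
  qed
  have [measurable]: "(\<lambda>z. snd z j) \<in> borel_measurable PQ" if "j = b \<or> j \<in> J" for j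
  proof -
    have "(\<lambda>z. snd z j) \<in> measurable PQ \<nu>"
      unfolding PQ_def using that
      by (intro measurable_compose[OF measurable_snd measurable_component_singleton]) auto
    then show ?thesis by (simp cong: measurable_cong_sets)
  qed
  have [measurable]: "(\<lambda>z. card {j\<in>I. fst z j < snd z b}) \<in> measurable PQ (count_space UNIV)"
      "(\<lambda>z. card {j\<in>I. fst z a < fst z j}) \<in> measurable PQ (count_space UNIV)"
      "(\<lambda>z. card {j\<in>J. snd z j < snd z b}) \<in> measurable PQ (count_space UNIV)"
      "(\<lambda>z. card {j\<in>J. fst z a < snd z j}) \<in> measurable PQ (count_space UNIV)"
    by (rule measurable_card_Collect; simp; measurable)+
  show E [measurable]: "E \<in> sets PQ" unfolding E_def by measurable
  let ?PI = "PiM I (\<lambda>_. \<mu>)" and ?PJ = "PiM J (\<lambda>_. \<nu>)"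
  define C where "C \<eta> \<xi> = {x \<in> space ?PI. card {j\<in>I. x j \<in> {..<\<eta>}} = i \<and> card {j\<in>I. x j \<in> {\<xi><..}} = s}"
    for \<eta> \<xi> :: real
  define D where "D \<eta> \<xi> = {y \<in> space ?PJ. card {j\<in>J. y j \<in> {..<\<eta>}} = r \<and> card {j\<in>J. y j \<in> {\<xi><..}} = k}"
    for \<eta> \<xi> :: real
  interpret FI: prob_space ?PI by (intro prob_space_PiM) (rule \<mu>.prob_space_axioms)
  interpret FJ: prob_space ?PJ by (intro prob_space_PiM) (rule \<nu>.prob_space_axioms)
  have C [measurable]: "C \<eta> \<xi> \<in> sets ?PI" for \<eta> \<xi>
  proof -
    have [measurable]: "(\<lambda>x. card {j\<in>I. x j \<in> A}) \<in> measurable ?PI (count_space UNIV)" if "A \<in> sets \<mu>" for A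
      by (intro measurable_card_Collect pred_sets2[OF that] measurable_component_singleton)
    show ?thesis unfolding C_def by measurable
  qed
  have D [measurable]: "D \<eta> \<xi> \<in> sets ?PJ" for \<eta> \<xi>
  proof -
    have [measurable]: "(\<lambda>x. card {j\<in>J. x j \<in> A}) \<in> measurable ?PJ (count_space UNIV)" if "A \<in> sets \<nu>" for A
      by (intro measurable_card_Collect pred_sets2[OF that] measurable_component_singleton)
    show ?thesis unfolding D_def by measurable
  qed
  have PC: "measure ?PI (C \<eta> \<xi>) = trinomial (card I) i s (1 - cdf \<mu> \<eta>) (1 - cdf \<mu> \<xi>)" if "\<eta> < \<xi>" for \<eta> \<xi>
    unfolding C_def trinomial_def using that
    by (subst measure_PiM_two_counts[OF \<mu>.prob_space_axioms I(1)])
       (auto simp: measure_below_above[OF \<mu>])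
  have PD: "measure ?PJ (D \<eta> \<xi>) = trinomial (card J) r k (1 - cdf \<nu> \<eta>) (1 - cdf \<nu> \<xi>)" if "\<eta> < \<xi>" for \<eta> \<xi>
    unfolding D_def trinomial_def using that
    by (subst measure_PiM_two_counts[OF \<nu>.prob_space_axioms J(1)])
       (auto simp: measure_below_above[OF \<nu>])
  have split: "indicator E (x(a := \<xi>), y(b := \<eta>))
      = (indicator {\<eta><..} \<xi> * indicator (C \<eta> \<xi>) x * indicator (D \<eta> \<xi>) y :: ennreal)"
    if "x \<in> space ?PI" "y \<in> space ?PJ" for x y \<xi> \<eta>
  proof -
    have "(x(a := \<xi>), y(b := \<eta>)) \<in> space PQ"
      using that by (auto simp: PQ_def space_pair_measure space_PiM PiE_iff extensional_def)
    moreover have "{j\<in>I. (x(a := \<xi>)) j < \<eta>} = {j\<in>I. x j < \<eta>}"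
        "{j\<in>I. \<xi> < (x(a := \<xi>)) j} = {j\<in>I. \<xi> < x j}"
        "{j\<in>J. (y(b := \<eta>)) j < \<eta>} = {j\<in>J. y j < \<eta>}"
        "{j\<in>J. \<xi> < (y(b := \<eta>)) j} = {j\<in>J. \<xi> < y j}"
      using I(2) J(2) by auto
    ultimately show ?thesis using that by (auto simp: E_def C_def D_def indicator_def)
  qed
  have "emeasure PQ E = (\<integral>\<^sup>+z. indicator E z \<partial>PQ)"
    by (rule nn_integral_indicator[symmetric]) (rule E)
  also have "\<dots> = (\<integral>\<^sup>+\<eta>. \<integral>\<^sup>+\<xi>. \<integral>\<^sup>+x. \<integral>\<^sup>+y. indicator E (x(a := \<xi>), y(b := \<eta>)) \<partial>?PJ \<partial>?PI \<partial>\<mu> \<partial>\<nu>)"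
    unfolding PQ_def
    by (rule nn_integral_pair_PiM_single_out[OF \<mu>.prob_space_axioms \<nu>.prob_space_axioms I J])
       (use E in \<open>auto simp: PQ_def\<close>)
  also have "\<dots> = (\<integral>\<^sup>+\<eta>. \<integral>\<^sup>+\<xi>. indicator {\<eta><..} \<xi> *
         ennreal (trinomial (card I) i s (1 - cdf \<mu> \<eta>) (1 - cdf \<mu> \<xi>) *
                  trinomial (card J) r k (1 - cdf \<nu> \<eta>) (1 - cdf \<nu> \<xi>)) \<partial>\<mu> \<partial>\<nu>)"
  proof (intro nn_integral_cong)
    fix \<eta> \<xi>
    have "(\<integral>\<^sup>+x. \<integral>\<^sup>+y. indicator E (x(a := \<xi>), y(b := \<eta>)) \<partial>?PJ \<partial>?PI)
       = (\<integral>\<^sup>+x. \<integral>\<^sup>+y. indicator {\<eta><..} \<xi> * indicator (C \<eta> \<xi>) x * indicator (D \<eta> \<xi>) y \<partial>?PJ \<partial>?PI)"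
      by (intro nn_integral_cong split)
    also have "\<dots> = indicator {\<eta><..} \<xi> * emeasure ?PI (C \<eta> \<xi>) * emeasure ?PJ (D \<eta> \<xi>)"
      by (simp add: nn_integral_cmult nn_integral_multc)
    also have "\<dots> = indicator {\<eta><..} \<xi> *
         ennreal (trinomial (card I) i s (1 - cdf \<mu> \<eta>) (1 - cdf \<mu> \<xi>) *
                  trinomial (card J) r k (1 - cdf \<nu> \<eta>) (1 - cdf \<nu> \<xi>))"
      by (simp add: FI.emeasure_eq_measure FJ.emeasure_eq_measure PC[symmetric] PD[symmetric]
          mult.assoc ennreal_mult split: split_indicator)
    finally show "(\<integral>\<^sup>+x. \<integral>\<^sup>+y. indicator E (x(a := \<xi>), y(b := \<eta>)) \<partial>?PJ \<partial>?PI) = \<dots>" .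
  qed
  finally show "emeasure PQ E = (\<integral>\<^sup>+\<eta>. \<integral>\<^sup>+\<xi>. indicator {\<eta><..} \<xi> *
         ennreal (trinomial (card I) i s (1 - cdf \<mu> \<eta>) (1 - cdf \<mu> \<xi>) *
                  trinomial (card J) r k (1 - cdf \<nu> \<eta>) (1 - cdf \<nu> \<xi>)) \<partial>\<mu> \<partial>\<nu>)" .
qed

text \<open>
The survival functions \<open>S\<close> and \<open>T\<close> are linked by \<open>T = S powr \<theta>\<close>. The inner integral becomes one over
\<open>v = S \<xi>\<close>, which is uniform; the outer one becomes an integral over \<open>t = T \<eta>\<close>, which is uniform as
well, through \<open>S \<eta> = t powr (1 / \<theta>)\<close>. After the rescaling \<open>v = u * w\<close> with \<open>u = S \<eta>\<close> the integrand factors.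
\<close>

lemma nn_integral_separated:
  assumes \<mu>: "real_distribution \<mu>" "\<And>x. isCont (cdf \<mu>) x"
    and \<nu>: "real_distribution \<nu>" "\<And>x. isCont (cdf \<nu>) x"
    and \<theta>: "\<theta> > 0" and link: "\<And>x. 1 - cdf \<nu> x = (1 - cdf \<mu> x) powr \<theta>"
    and S: "S = (\<lambda>x. 1 - cdf \<mu> x)" and T: "T = (\<lambda>x. 1 - cdf \<nu> x)"
  shows "(\<integral>\<^sup>+\<eta>. \<integral>\<^sup>+\<xi>. indicator {\<eta><..} \<xi> *
         ennreal ((1 - S \<eta>) ^ i * S \<xi> ^ s * (S \<eta> - S \<xi>) ^ a *
           ((1 - T \<eta>) ^ r * T \<xi> ^ k * (T \<eta> - T \<xi>) ^ b)) \<partial>\<mu> \<partial>\<nu>)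
     = ennreal (outer_value i a s r b k \<theta> * inner_value a s b k \<theta>)"
proof -
  interpret \<mu>: real_distribution \<mu> by fact
  interpret \<nu>: real_distribution \<nu> by fact
  have [measurable]: "cdf \<mu> \<in> borel_measurable borel" "cdf \<nu> \<in> borel_measurable borel"
    using \<mu>(1) \<nu>(1) by (auto intro!: cdf_distribution.measurable_C simp: cdf_distribution_def)
  have TS: "T x = S x powr \<theta>" for x using link by (simp add: S T)
  have ST: "S x = T x powr (1 / \<theta>)" for x
    using \<theta> \<mu>.cdf_bounded_prob[of x] by (simp add: TS powr_powr S)
  define h where "h u v = (1 - u) ^ i * v ^ s * (u - v) ^ a *
      ((1 - u powr \<theta>) ^ r * (v powr \<theta>) ^ k * (u powr \<theta> - v powr \<theta>) ^ b)" for u v :: real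
  have [measurable]: "(\<lambda>z. h (fst z) (snd z)) \<in> borel_measurable (borel \<Otimes>\<^sub>M borel)"
    unfolding h_def by measurable
  have [measurable]: "h u \<in> borel_measurable borel" for u
    unfolding h_def by measurable
  define H where "H u = (\<integral>\<^sup>+v\<in>{0<..<1}. (if v < u then ennreal (h u v) else 0) \<partial>lborel)" for u
  have [measurable]: "H \<in> borel_measurable borel"
    unfolding H_def h_def by measurable

  \<comment> \<open>Substituting \<open>v = S \<xi>\<close>. The events \<open>\<eta> < \<xi>\<close> and \<open>S \<xi> < S \<eta>\<close> differ only where \<open>S\<close> is constant
      between \<open>\<eta>\<close> and \<open>\<xi>\<close>, which has probability zero because \<open>S \<xi>\<close> is uniformly distributed.\<close>
  have inner: "(\<integral>\<^sup>+\<xi>. indicator {\<eta><..} \<xi> *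
         ennreal ((1 - S \<eta>) ^ i * S \<xi> ^ s * (S \<eta> - S \<xi>) ^ a *
           ((1 - T \<eta>) ^ r * T \<xi> ^ k * (T \<eta> - T \<xi>) ^ b)) \<partial>\<mu>) = H (S \<eta>)" for \<eta>
  proof -
    have "(\<integral>\<^sup>+\<xi>. indicator {S \<eta>} (1 - cdf \<mu> \<xi>) \<partial>\<mu>)
        = (\<integral>\<^sup>+u\<in>{0<..<1}. indicator {S \<eta>} u \<partial>lborel)"
      by (rule nn_integral_survival[OF \<mu>]) auto
    also have "\<dots> = emeasure lborel ({S \<eta>} \<inter> {0<..<1})"
      by (simp add: indicator_inter_arith flip: nn_integral_indicator)
    also have "\<dots> = 0"
      by (rule emeasure_lborel_countable) auto
    finally have "AE \<xi> in \<mu>. indicator {S \<eta>} (1 - cdf \<mu> \<xi>) = (0 :: ennreal)"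
      by (subst (asm) nn_integral_0_iff_AE) (simp_all cong: measurable_cong_sets)
    then have "AE \<xi> in \<mu>. indicator {\<eta><..} \<xi> *
         ennreal ((1 - S \<eta>) ^ i * S \<xi> ^ s * (S \<eta> - S \<xi>) ^ a *
           ((1 - T \<eta>) ^ r * T \<xi> ^ k * (T \<eta> - T \<xi>) ^ b))
       = (if 1 - cdf \<mu> \<xi> < S \<eta> then ennreal (h (S \<eta>) (1 - cdf \<mu> \<xi>)) else 0)"
    proof eventually_elim
      case (elim \<xi>)
      then have ne: "S \<xi> \<noteq> S \<eta>" by (auto simp: S)
      have "\<eta> < \<xi> \<longleftrightarrow> S \<xi> < S \<eta>"
        using ne \<mu>.cdf_nondecreasing[of \<eta> \<xi>] \<mu>.cdf_nondecreasing[of \<xi> \<eta>]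
        unfolding S by (cases "\<eta> < \<xi>") linarith+
      then show ?case by (simp add: h_def TS) (simp add: S)
    qed
    then have "(\<integral>\<^sup>+\<xi>. indicator {\<eta><..} \<xi> *
         ennreal ((1 - S \<eta>) ^ i * S \<xi> ^ s * (S \<eta> - S \<xi>) ^ a *
           ((1 - T \<eta>) ^ r * T \<xi> ^ k * (T \<eta> - T \<xi>) ^ b)) \<partial>\<mu>)
      = (\<integral>\<^sup>+\<xi>. (if 1 - cdf \<mu> \<xi> < S \<eta> then ennreal (h (S \<eta>) (1 - cdf \<mu> \<xi>)) else 0) \<partial>\<mu>)"
      by (rule nn_integral_cong_AE)
    also have "\<dots> = H (S \<eta>)"
      unfolding H_def
      by (rule nn_integral_survival[OF \<mu>, where g = "\<lambda>v. if v < S \<eta> then ennreal (h (S \<eta>) v) else 0"]) measurable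
    finally show ?thesis .
  qed

  define A where "A t = t powr (real (s + a + 1) / \<theta> + real (k + b)) * (1 - t powr (1 / \<theta>)) ^ i
      * (1 - t powr 1) ^ r" for t :: real
  define B where "B w = w powr (real s + real k * \<theta>) * (1 - w powr 1) ^ a * (1 - w powr \<theta>) ^ b"
    for w :: real
  define IA where "IA = outer_value i a s r b k \<theta>"
  define IB where "IB = inner_value a s b k \<theta>"
  have [measurable]: "A \<in> borel_measurable borel" "B \<in> borel_measurable borel"
    unfolding A_def B_def by measurable
  have powr_le1: "0 \<le> 1 - t powr e" if "0 < t" "t < 1" "e > 0" for t e :: real
    using that by (simp add: powr_le1)
  have A0: "0 \<le> A t" if "0 < t" "t < 1" for t
    unfolding A_def using that \<theta> powr_le1[OF that] by (intro mult_nonneg_nonneg zero_le_power) auto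
  have B0: "0 \<le> B t" if "0 < t" "t < 1" for t
    unfolding B_def using that \<theta> powr_le1[OF that] by (intro mult_nonneg_nonneg zero_le_power) auto
  have intA: "(\<integral>\<^sup>+t\<in>{0<..<1}. ennreal (A t) \<partial>lborel) = ennreal IA"
    using A0 has_integral_outer[OF \<theta>] unfolding A_def IA_def by (intro nn_integral_unit_interval) auto
  have intB: "(\<integral>\<^sup>+t\<in>{0<..<1}. ennreal (B t) \<partial>lborel) = ennreal IB"
    using B0 has_integral_inner[OF \<theta>] unfolding B_def IB_def by (intro nn_integral_unit_interval) auto

  \<comment> \<open>With \<open>v = u * w\<close> every factor of the integrand is a function of \<open>u\<close> times a function of \<open>w\<close>.\<close>
  have sep: "H (t powr (1 / \<theta>)) = ennreal (A t) * ennreal IB" if t: "0 < t" "t < 1" for t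
  proof -
    define u where "u = t powr (1 / \<theta>)"
    have u: "0 < u" "u < 1" using t \<theta> powr_less_mono2[of "1 / \<theta>" t 1] by (auto simp: u_def)
    have ut: "u powr \<theta> = t" using t \<theta> by (simp add: u_def powr_powr)
    have key: "u * h u (u * w) = A t * B w" if w: "0 < w" "w < 1" for w
    proof -
      have up: "t powr (real (s + a + 1) / \<theta> + real (k + b)) = u ^ (s + a + 1) * t ^ (k + b)"
      proof -
        have "u ^ (s + a + 1) = t powr (real (s + a + 1) / \<theta>)"
          unfolding powr_realpow[OF u(1), symmetric] by (simp add: u_def powr_powr)
        moreover have "t ^ (k + b) = t powr real (k + b)" using t by (simp only: powr_realpow)
        ultimately show ?thesis by (simp only: powr_add)
      qed
      have wp: "w powr (real s + real k * \<theta>) = w ^ s * (w powr \<theta>) ^ k"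
        using w by (simp add: powr_add powr_realpow[symmetric] powr_powr mult.commute)
      have uw: "u - u * w = u * (1 - w)" by (simp add: algebra_simps)
      have uw': "(u * w) powr \<theta> = t * w powr \<theta>" using u w by (simp add: powr_mult ut)
      have tw: "t - t * w powr \<theta> = t * (1 - w powr \<theta>)" by (simp add: algebra_simps)
      show ?thesis
        unfolding h_def A_def B_def up wp uw uw' ut tw using t w
        by (simp add: power_mult_distrib power_add u_def[symmetric])
    qed
    have "H u = (\<integral>\<^sup>+v. (if 0 < v \<and> v < u then ennreal (h u v) else 0) \<partial>lborel)"
      unfolding H_def using u by (intro nn_integral_cong) (auto split: split_indicator)
    also have "\<dots> = ennreal \<bar>u\<bar> * (\<integral>\<^sup>+w. (if 0 < 0 + u * w \<and> 0 + u * w < u then ennreal (h u (0 + u * w)) else 0) \<partial>lborel)"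
      using u by (intro nn_integral_real_affine) auto
    also have "\<dots> = (\<integral>\<^sup>+w. ennreal \<bar>u\<bar> * (if 0 < 0 + u * w \<and> 0 + u * w < u then ennreal (h u (0 + u * w)) else 0) \<partial>lborel)"
      by (rule nn_integral_cmult[symmetric]) measurable
    also have "\<dots> = (\<integral>\<^sup>+w. ennreal (A t) * (ennreal (B w) * indicator {0<..<1} w) \<partial>lborel)"
    proof (rule nn_integral_cong)
      fix w
      show "ennreal \<bar>u\<bar> * (if 0 < 0 + u * w \<and> 0 + u * w < u then ennreal (h u (0 + u * w)) else 0)
          = ennreal (A t) * (ennreal (B w) * indicator {0<..<1} w)"
      proof (cases "0 < w \<and> w < 1")
        case True
        have "ennreal \<bar>u\<bar> * ennreal (h u (u * w)) = ennreal (u * h u (u * w))"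
          using u by (simp add: ennreal_mult')
        also have "\<dots> = ennreal (A t) * ennreal (B w)"
          using key True A0[OF t] by (simp add: ennreal_mult')
        finally show ?thesis using True u by (simp add: zero_less_mult_iff)
      next
        case False
        then show ?thesis using u by (auto simp: zero_less_mult_iff split: split_indicator)
      qed
    qed
    also have "\<dots> = ennreal (A t) * ennreal IB"
      by (subst nn_integral_cmult) (auto simp: intB)
    finally show ?thesis by (simp add: u_def)
  qed

  have "(\<integral>\<^sup>+\<eta>. H (S \<eta>) \<partial>\<nu>) = (\<integral>\<^sup>+\<eta>. H ((1 - cdf \<nu> \<eta>) powr (1 / \<theta>)) \<partial>\<nu>)"
    by (simp add: ST T)
  also have "\<dots> = (\<integral>\<^sup>+t\<in>{0<..<1}. H (t powr (1 / \<theta>)) \<partial>lborel)"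
    by (rule nn_integral_survival[OF \<nu>, where g = "\<lambda>t. H (t powr (1 / \<theta>))"]) measurable
  also have "\<dots> = (\<integral>\<^sup>+t. (ennreal (A t) * indicator {0<..<1} t) * ennreal IB \<partial>lborel)"
    by (intro nn_integral_cong) (auto simp: sep split: split_indicator)
  also have "\<dots> = ennreal IA * ennreal IB"
    by (subst nn_integral_multc) (auto simp: intA)
  also have "\<dots> = ennreal (outer_value i a s r b k \<theta> * inner_value a s b k \<theta>)"
    unfolding IA_def IB_def by (rule ennreal_mult'[symmetric]) (rule outer_value_nonneg[OF \<theta>])
  finally show ?thesis unfolding inner .
qed

section \<open>Two independent samples from continuous laws\<close>

text \<open>
By Fubini the diagonal has measure zero under a product with an atomless factor.
\<close>

lemma (in prob_space) AE_neq_of_indep_var: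
  fixes Z W :: "'a \<Rightarrow> real"
  assumes indep: "indep_var borel Z borel W" and atomless: "\<And>z. measure (distr M borel W) {z} = 0"
  shows "AE \<omega> in M. Z \<omega> \<noteq> W \<omega>"
proof -
  note rv [measurable] = indep_var_rv1[OF indep] indep_var_rv2[OF indep]
  interpret W: prob_space "distr M borel W" by (rule prob_space_distr) (rule rv(2))
  have [measurable]: "{z :: real \<times> real. fst z = snd z} \<in> sets (borel \<Otimes>\<^sub>M borel)"
  proof -
    have "(\<lambda>z::real \<times> real. fst z - snd z) -` {0} \<inter> space (borel \<Otimes>\<^sub>M borel) \<in> sets (borel \<Otimes>\<^sub>M borel)"
      by (rule measurable_sets[where A = borel]) auto
    moreover have "(\<lambda>z::real \<times> real. fst z - snd z) -` {0} \<inter> space (borel \<Otimes>\<^sub>M borel)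
        = {z. fst z = snd z}" by (auto simp: space_pair_measure)
    ultimately show ?thesis by simp
  qed
  have "emeasure M {\<omega> \<in> space M. Z \<omega> = W \<omega>}
      = emeasure (distr M (borel \<Otimes>\<^sub>M borel) (\<lambda>\<omega>. (Z \<omega>, W \<omega>))) {z. fst z = snd z}"
    by (subst emeasure_distr) (auto intro!: arg_cong[where f = "emeasure M"])
  also have "distr M (borel \<Otimes>\<^sub>M borel) (\<lambda>\<omega>. (Z \<omega>, W \<omega>)) = distr M borel Z \<Otimes>\<^sub>M distr M borel W"
    using indep unfolding indep_var_distribution_eq by simp
  also have "emeasure (distr M borel Z \<Otimes>\<^sub>M distr M borel W) {z. fst z = snd z}
      = (\<integral>\<^sup>+z. emeasure (distr M borel W) (Pair z -` {z. fst z = snd z}) \<partial>distr M borel Z)"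
    by (rule W.emeasure_pair_measure_alt) (simp add: sets_pair_measure_cong[of "distr M borel Z" borel "distr M borel W" borel])
  also have "\<dots> = (\<integral>\<^sup>+z. 0 \<partial>distr M borel Z)"
  proof (rule nn_integral_cong)
    fix z :: real
    have "Pair z -` {z. fst z = snd z} = {z}" by auto
    then show "emeasure (distr M borel W) (Pair z -` {z. fst z = snd z}) = 0"
      using atomless[of z] by (simp add: W.emeasure_eq_measure)
  qed
  finally have "emeasure M {\<omega> \<in> space M. Z \<omega> = W \<omega>} = 0" by simp
  then show ?thesis
    by (intro AE_I[where N = "{\<omega> \<in> space M. Z \<omega> = W \<omega>}"]) auto
qed

lemma (in prob_space) indep_var_commute:
  assumes "indep_var S Z T W"
  shows "indep_var T W S Z"
proof -
  let ?S = "sigma_sets (space M) {Z -` A \<inter> space M |A. A \<in> sets S}"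
  let ?T = "sigma_sets (space M) {W -` A \<inter> space M |A. A \<in> sets T}"
  note * = assms[unfolded indep_var_eq indep_sets2_eq]
  from * have prod: "\<forall>A\<in>?S. \<forall>B\<in>?T. prob (A \<inter> B) = prob A * prob B" by (elim conjE)
  have "\<forall>B\<in>?T. \<forall>A\<in>?S. prob (B \<inter> A) = prob B * prob A"
  proof (intro ballI)
    fix B A assume "B \<in> ?T" "A \<in> ?S"
    then have "prob (A \<inter> B) = prob A * prob B" by (rule prod[rule_format, rotated])
    then show "prob (B \<inter> A) = prob B * prob A"
      by (subst Int_commute, subst mult.commute)
  qed
  with * show ?thesis unfolding indep_var_eq indep_sets2_eq by (elim conjE) (intro conjI)
qed

text \<open>
The hypotheses are symmetric in the two samples. This symmetry is what reduces the second regime to the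
first.
\<close>

locale two_continuous_samples = prob_space M
  for M :: "'a measure" +
  fixes m n :: nat and X Y :: "nat \<Rightarrow> 'a \<Rightarrow> real" and \<mu> \<nu> :: "real measure"
  assumes m: "1 \<le> m" and n: "1 \<le> n"
    and indep_X: "indep_vars (\<lambda>_. borel) X {1..m}" and indep_Y: "indep_vars (\<lambda>_. borel) Y {1..n}"
    and law_X: "\<And>i. i \<in> {1..m} \<Longrightarrow> distr M borel (X i) = \<mu>"
    and law_Y: "\<And>j. j \<in> {1..n} \<Longrightarrow> distr M borel (Y j) = \<nu>"
    and indep_XY: "indep_samples M m X n Y"
    and continuous_X: "\<And>x. isCont (cdf \<mu>) x" and continuous_Y: "\<And>x. isCont (cdf \<nu>) x"
begin

lemma measurable_X: "i \<in> {1..m} \<Longrightarrow> random_variable borel (X i)"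
  using indep_X unfolding indep_vars_def by blast

lemma measurable_Y: "j \<in> {1..n} \<Longrightarrow> random_variable borel (Y j)"
  using indep_Y unfolding indep_vars_def by blast

lemma swap: "two_continuous_samples M n m Y X \<nu> \<mu>"
  by (intro two_continuous_samples.intro two_continuous_samples_axioms.intro prob_space_axioms
      m n indep_X indep_Y law_X law_Y continuous_X continuous_Y
      indep_XY[unfolded indep_samples_def, THEN indep_var_commute, folded indep_samples_def])

lemma real_distribution_laws: "real_distribution \<mu>" "real_distribution \<nu>"
proof -
  have "1 \<in> {1..m}" "1 \<in> {1..n}" using m n by simp_all
  then show "real_distribution \<mu>" "real_distribution \<nu>"
    using real_distribution_distr measurable_X measurable_Y law_X law_Y by metis+
qed

lemma atomless: "measure \<mu> {z} = 0" "measure \<nu> {z} = 0"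
  using continuous_X[of z] continuous_Y[of z]
    finite_borel_measure.isCont_cdf[OF real_distribution.finite_borel_measure_M[OF real_distribution_laws(1)]]
    finite_borel_measure.isCont_cdf[OF real_distribution.finite_borel_measure_M[OF real_distribution_laws(2)]]
  by blast+

lemma AE_inj_X: "AE \<omega> in M. inj_on (\<lambda>i. X i \<omega>) {1..m}"
proof -
  have "AE \<omega> in M. X i \<omega> \<noteq> X j \<omega>" if ij: "i \<in> {1..m}" "j \<in> {1..m}" "i \<noteq> j" for i j
  proof -
    have "indep_var borel ((\<lambda>f. f i) \<circ> (\<lambda>\<omega>. restrict (\<lambda>l. X l \<omega>) {i}))
            borel ((\<lambda>f. f j) \<circ> (\<lambda>\<omega>. restrict (\<lambda>l. X l \<omega>) {j}))"
      using ij by (intro indep_var_compose[OF indep_var_restrict[OF indep_X]]) auto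
    then have "indep_var borel (X i) borel (X j)" by (simp add: comp_def)
    then show ?thesis by (rule AE_neq_of_indep_var) (simp only: law_X[OF ij(2)] atomless)
  qed
  then have "AE \<omega> in M. \<forall>i\<in>{1..m}. \<forall>j\<in>{1..m}. i \<noteq> j \<longrightarrow> X i \<omega> \<noteq> X j \<omega>"
    by (intro AE_finite_allI) auto
  then show ?thesis by eventually_elim (auto simp: inj_on_def)
qed

lemma AE_cross: "AE \<omega> in M. \<forall>i\<in>{1..m}. \<forall>j\<in>{1..n}. X i \<omega> \<noteq> Y j \<omega>"
proof (intro AE_finite_allI)
  fix i j assume ij: "i \<in> {1..m}" "j \<in> {1..n}"
  have "indep_var borel ((\<lambda>f. f i) \<circ> (\<lambda>\<omega>. \<lambda>i\<in>{1..m}. X i \<omega>)) borel ((\<lambda>f. f j) \<circ> (\<lambda>\<omega>. \<lambda>j\<in>{1..n}. Y j \<omega>))"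
    using ij by (intro indep_var_compose[OF indep_XY[unfolded indep_samples_def]]) auto
  then have "indep_var borel (X i) borel (Y j)" using ij by (simp add: comp_def)
  then show "AE \<omega> in M. X i \<omega> \<noteq> Y j \<omega>"
    by (rule AE_neq_of_indep_var) (simp only: law_Y[OF ij(2)] atomless)
qed auto

lemma AE_no_ties:
  "AE \<omega> in M. inj_on (\<lambda>i. X i \<omega>) {1..m} \<and> inj_on (\<lambda>j. Y j \<omega>) {1..n} \<and>
     (\<forall>i\<in>{1..m}. \<forall>j\<in>{1..n}. X i \<omega> \<noteq> Y j \<omega>)"
  using AE_inj_X two_continuous_samples.AE_inj_X[OF swap] AE_cross by eventually_elim simp

lemma distr_samples:
  "distr M (PiM {1..m} (\<lambda>_. borel) \<Otimes>\<^sub>M PiM {1..n} (\<lambda>_. borel))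
      (\<lambda>\<omega>. (\<lambda>i\<in>{1..m}. X i \<omega>, \<lambda>j\<in>{1..n}. Y j \<omega>))
    = PiM {1..m} (\<lambda>_. \<mu>) \<Otimes>\<^sub>M PiM {1..n} (\<lambda>_. \<nu>)"
proof -
  have "distr M (PiM {1..m} (\<lambda>_. borel)) (\<lambda>\<omega>. \<lambda>i\<in>{1..m}. X i \<omega>) = PiM {1..m} (\<lambda>i. distr M borel (X i))"
    using indep_vars_iff_distr_eq_PiM'[where X = X and I = "{1..m}" and M' = "\<lambda>_. borel"]
      indep_X measurable_X m by auto
  also have "\<dots> = PiM {1..m} (\<lambda>_. \<mu>)" by (intro PiM_cong law_X refl)
  finally have X: "distr M (PiM {1..m} (\<lambda>_. borel)) (\<lambda>\<omega>. \<lambda>i\<in>{1..m}. X i \<omega>) = \<dots>" .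
  have "distr M (PiM {1..n} (\<lambda>_. borel)) (\<lambda>\<omega>. \<lambda>i\<in>{1..n}. Y i \<omega>) = PiM {1..n} (\<lambda>i. distr M borel (Y i))"
    using indep_vars_iff_distr_eq_PiM'[where X = Y and I = "{1..n}" and M' = "\<lambda>_. borel"]
      indep_Y measurable_Y n by auto
  also have "\<dots> = PiM {1..n} (\<lambda>_. \<nu>)" by (intro PiM_cong law_Y refl)
  finally have Y: "distr M (PiM {1..n} (\<lambda>_. borel)) (\<lambda>\<omega>. \<lambda>i\<in>{1..n}. Y i \<omega>) = \<dots>" .
  show ?thesis
    using indep_XY unfolding indep_samples_def indep_var_distribution_eq X Y by simp
qed

lemma emeasure_separated_at:
  fixes i s r k :: nat
  assumes a: "a \<in> {1..m}" and b: "b \<in> {1..n}"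
  defines "S \<equiv> {\<omega> \<in> space M. separated_at m n i s r k (\<lambda>i. X i \<omega>) (\<lambda>j. Y j \<omega>) a b}"
  shows "S \<in> events"
    and "emeasure M S = (\<integral>\<^sup>+\<eta>. \<integral>\<^sup>+\<xi>. indicator {\<eta><..} \<xi> *
         ennreal (trinomial (m - 1) i s (1 - cdf \<mu> \<eta>) (1 - cdf \<mu> \<xi>) *
                  trinomial (n - 1) r k (1 - cdf \<nu> \<eta>) (1 - cdf \<nu> \<xi>)) \<partial>\<mu> \<partial>\<nu>)"
proof -
  let ?I = "{1..m} - {a}" and ?J = "{1..n} - {b}"
  let ?B = "PiM {1..m} (\<lambda>_. borel) \<Otimes>\<^sub>M PiM {1..n} (\<lambda>_. borel) :: ((nat \<Rightarrow> real) \<times> (nat \<Rightarrow> real)) measure"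
  let ?PQ = "PiM {1..m} (\<lambda>_. \<mu>) \<Otimes>\<^sub>M PiM {1..n} (\<lambda>_. \<nu>)"
  let ?f = "\<lambda>\<omega>. (\<lambda>i\<in>{1..m}. X i \<omega>, \<lambda>j\<in>{1..n}. Y j \<omega>)"
  let ?E = "{z \<in> space ?PQ. snd z b < fst z a
        \<and> card {j\<in>?I. fst z j < snd z b} = i \<and> card {j\<in>?I. fst z a < fst z j} = s
        \<and> card {j\<in>?J. snd z j < snd z b} = r \<and> card {j\<in>?J. fst z a < snd z j} = k}"
  have ins: "insert a ?I = {1..m}" "insert b ?J = {1..n}" using a b by auto
  have sets_E: "?E \<in> sets ?PQ"
    using emeasure_separated_configuration(1)[OF real_distribution_laws(1) continuous_X
        real_distribution_laws(2) continuous_Y, of ?I a ?J b i s r k] unfolding ins by simp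
  have eq: "emeasure ?PQ ?E = (\<integral>\<^sup>+\<eta>. \<integral>\<^sup>+\<xi>. indicator {\<eta><..} \<xi> *
         ennreal (trinomial (card ?I) i s (1 - cdf \<mu> \<eta>) (1 - cdf \<mu> \<xi>) *
                  trinomial (card ?J) r k (1 - cdf \<nu> \<eta>) (1 - cdf \<nu> \<xi>)) \<partial>\<mu> \<partial>\<nu>)"
    using emeasure_separated_configuration(2)[OF real_distribution_laws(1) continuous_X
        real_distribution_laws(2) continuous_Y, of ?I a ?J b i s r k] unfolding ins by simp
  have cards: "card ?I = m - 1" "card ?J = n - 1" using a b by simp_all
  have f: "?f \<in> measurable M ?B"
    using indep_XY unfolding indep_samples_def indep_var_distribution_eq by (auto intro: measurable_Pair)
  have sets_B: "?E \<in> sets ?B"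
    using sets_E unfolding distr_samples[symmetric] by simp
  have pre: "?f -` ?E \<inter> space M = S"
  proof -
    have "?f \<omega> \<in> space ?PQ" if "\<omega> \<in> space M" for \<omega>
      using measurable_space[OF f that] unfolding distr_samples[symmetric] by simp
    moreover have "{j\<in>?I. (\<lambda>i\<in>{1..m}. X i \<omega>) j < c} = {j\<in>?I. X j \<omega> < c}"
        "{j\<in>?I. c < (\<lambda>i\<in>{1..m}. X i \<omega>) j} = {j\<in>?I. c < X j \<omega>}"
        "{j\<in>?J. (\<lambda>j\<in>{1..n}. Y j \<omega>) j < c} = {j\<in>?J. Y j \<omega> < c}"
        "{j\<in>?J. c < (\<lambda>j\<in>{1..n}. Y j \<omega>) j} = {j\<in>?J. c < Y j \<omega>}" for \<omega> c
      by auto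
    moreover have "(\<lambda>i\<in>{1..m}. X i \<omega>) a = X a \<omega>" "(\<lambda>j\<in>{1..n}. Y j \<omega>) b = Y b \<omega>" for \<omega>
      using a b by simp_all
    ultimately show ?thesis unfolding S_def separated_at_def by (intro set_eqI) (simp only:
      vimage_eq Int_iff mem_Collect_eq fst_conv snd_conv, blast)
  qed
  show "S \<in> events" using measurable_sets[OF f sets_B] unfolding pre .
  have "emeasure M S = emeasure ?PQ ?E"
    using emeasure_distr[OF f sets_B] unfolding pre distr_samples by (rule sym)
  then show "emeasure M S = (\<integral>\<^sup>+\<eta>. \<integral>\<^sup>+\<xi>. indicator {\<eta><..} \<xi> *
         ennreal (trinomial (m - 1) i s (1 - cdf \<mu> \<eta>) (1 - cdf \<mu> \<xi>) *
                  trinomial (n - 1) r k (1 - cdf \<nu> \<eta>) (1 - cdf \<nu> \<xi>)) \<partial>\<mu> \<partial>\<nu>)"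
    unfolding eq cards .
qed

lemma prob_separated_at:
  assumes a: "a \<in> {1..m}" and b: "b \<in> {1..n}"
    and \<theta>: "\<theta> > 0" and link: "\<And>x. 1 - cdf \<nu> x = (1 - cdf \<mu> x) powr \<theta>"
  shows "prob {\<omega> \<in> space M. separated_at m n i s r k (\<lambda>i. X i \<omega>) (\<lambda>j. Y j \<omega>) a b}
    = real (m - 1 choose i) * real (m - 1 - i choose s) * (real (n - 1 choose r) * real (n - 1 - r choose k))
        * (outer_value i (m - 1 - i - s) s r (n - 1 - r - k) k \<theta> * inner_value (m - 1 - i - s) s (n - 1 - r - k) k \<theta>)"
    (is "prob ?S = ?c * ?Q")
proof -
  interpret \<mu>: real_distribution \<mu> by (rule real_distribution_laws)
  interpret \<nu>: real_distribution \<nu> by (rule real_distribution_laws)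
  have [measurable]: "cdf \<mu> \<in> borel_measurable borel" "cdf \<nu> \<in> borel_measurable borel"
    using real_distribution_laws
    by (auto intro!: cdf_distribution.measurable_C simp: cdf_distribution_def)
  define g where "g \<eta> \<xi> = indicator {\<eta><..} \<xi> *
      ennreal ((1 - (1 - cdf \<mu> \<eta>)) ^ i * (1 - cdf \<mu> \<xi>) ^ s * ((1 - cdf \<mu> \<eta>) - (1 - cdf \<mu> \<xi>)) ^ (m - 1 - i - s) *
        ((1 - (1 - cdf \<nu> \<eta>)) ^ r * (1 - cdf \<nu> \<xi>) ^ k * ((1 - cdf \<nu> \<eta>) - (1 - cdf \<nu> \<xi>)) ^ (n - 1 - r - k)))"
    for \<eta> \<xi> :: real
  have g_alt: "g \<eta> \<xi> = (if \<eta> < \<xi> then ennreal ((1 - (1 - cdf \<mu> \<eta>)) ^ i * (1 - cdf \<mu> \<xi>) ^ s * ((1 - cdf \<mu> \<eta>) - (1 - cdf \<mu> \<xi>)) ^ (m - 1 - i - s) *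
        ((1 - (1 - cdf \<nu> \<eta>)) ^ r * (1 - cdf \<nu> \<xi>) ^ k * ((1 - cdf \<nu> \<eta>) - (1 - cdf \<nu> \<xi>)) ^ (n - 1 - r - k))) else 0)" for \<eta> \<xi>
    unfolding g_def by simp
  have [measurable]: "case_prod g \<in> borel_measurable (\<nu> \<Otimes>\<^sub>M \<mu>)"
    unfolding g_alt[abs_def] by measurable
  have "emeasure M ?S = (\<integral>\<^sup>+\<eta>. \<integral>\<^sup>+\<xi>. ennreal ?c * g \<eta> \<xi> \<partial>\<mu> \<partial>\<nu>)"
    unfolding emeasure_separated_at(2)[OF a b] g_def trinomial_def
    by (intro nn_integral_cong)
       (simp add: ennreal_mult'[symmetric] mult_ac split: split_indicator)
  also have "\<dots> = (\<integral>\<^sup>+\<eta>. ennreal ?c * (\<integral>\<^sup>+\<xi>. g \<eta> \<xi> \<partial>\<mu>) \<partial>\<nu>)"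
    by (intro nn_integral_cong nn_integral_cmult) measurable
  also have "\<dots> = ennreal ?c * (\<integral>\<^sup>+\<eta>. \<integral>\<^sup>+\<xi>. g \<eta> \<xi> \<partial>\<mu> \<partial>\<nu>)"
    by (intro nn_integral_cmult) measurable
  also have "(\<integral>\<^sup>+\<eta>. \<integral>\<^sup>+\<xi>. g \<eta> \<xi> \<partial>\<mu> \<partial>\<nu>) = ennreal ?Q"
    unfolding g_def
    by (rule nn_integral_separated[OF real_distribution_laws(1) continuous_X
        real_distribution_laws(2) continuous_Y \<theta> link refl refl])
  also have "ennreal ?c * ennreal ?Q = ennreal (?c * ?Q)" by (rule ennreal_mult'[symmetric]) simp
  finally show ?thesis
    using outer_value_nonneg[OF \<theta>] inner_value_nonneg[OF \<theta>] by (simp add: measure_def)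
qed

lemma stats_event:
  "{\<omega> \<in> space M. exceedance_stat m n X Y s \<omega> = k \<and> precedence_stat m n X Y r \<omega> = i} \<in> events"
  if s: "s < m" and r: "r < n"
proof -
  have ex: "exceedance_stat m n X Y s \<omega> =
      card {j\<in>{1..n}. m - s \<le> card {l\<in>{1..m}. X l \<omega> < Y j \<omega>}}" for \<omega>
  proof -
    have "order_stat m (\<lambda>i. X i \<omega>) (m - s) < c \<longleftrightarrow> m - s \<le> card {l\<in>{1..m}. X l \<omega> < c}" for c
      using s by (intro order_stat_less_iff) auto
    then show ?thesis unfolding exceedance_stat_def by simp
  qed
  have pr: "precedence_stat m n X Y r \<omega> =
      card {l\<in>{1..m}. \<not> 1 + r \<le> card {j\<in>{1..n}. Y j \<omega> \<le> X l \<omega>}}" for \<omega>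
  proof -
    have "order_stat n (\<lambda>j. Y j \<omega>) (1 + r) \<le> c \<longleftrightarrow> 1 + r \<le> card {j\<in>{1..n}. Y j \<omega> \<le> c}" for c
      using r by (intro order_stat_le_iff) auto
    then have "c < order_stat n (\<lambda>j. Y j \<omega>) (1 + r) \<longleftrightarrow> \<not> 1 + r \<le> card {j\<in>{1..n}. Y j \<omega> \<le> c}" for c
      by (meson not_le)
    then show ?thesis unfolding precedence_stat_def by simp
  qed
  have [measurable]: "i \<in> {1..m} \<Longrightarrow> random_variable borel (X i)" for i by (rule measurable_X)
  have [measurable]: "j \<in> {1..n} \<Longrightarrow> random_variable borel (Y j)" for j by (rule measurable_Y)
  have 1: "(\<lambda>\<omega>. card {l\<in>{1..m}. X l \<omega> < Y j \<omega>}) \<in> measurable M (count_space UNIV)" if "j \<in> {1..n}" for j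
    using that by (intro measurable_card_Collect) measurable
  have 2: "(\<lambda>\<omega>. card {j\<in>{1..n}. Y j \<omega> \<le> X l \<omega>}) \<in> measurable M (count_space UNIV)" if "l \<in> {1..m}" for l
    using that by (intro measurable_card_Collect) measurable
  have [measurable]: "exceedance_stat m n X Y s \<in> measurable M (count_space UNIV)"
    unfolding ex[abs_def]
  proof (rule measurable_card_Collect)
    fix j assume "j \<in> {1..n}"
    note 1[OF this, measurable]
    show "Measurable.pred M (\<lambda>\<omega>. m - s \<le> card {l\<in>{1..m}. X l \<omega> < Y j \<omega>})" by measurable
  qed
  have [measurable]: "precedence_stat m n X Y r \<in> measurable M (count_space UNIV)"
    unfolding pr[abs_def]
  proof (rule measurable_card_Collect)
    fix l assume "l \<in> {1..m}"
    note 2[OF this, measurable]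
    show "Measurable.pred M (\<lambda>\<omega>. \<not> 1 + r \<le> card {j\<in>{1..n}. Y j \<omega> \<le> X l \<omega>})" by measurable
  qed
  show ?thesis by measurable
qed

text \<open>
Outside a null set without ties, the event is the disjoint union of the \<open>m * n\<close> events
\<open>separated_at\<close>. These all have the same probability, so the factors \<open>m\<close> and \<open>n\<close> complete the
binomial coefficients of the \<open>m - 1\<close> and \<open>n - 1\<close> other observations to quotients of factorials; the
factorials of \<open>i\<close> and of the number of \<open>X\<close>-values in between cancel against those in the integrals.
\<close>

lemma prob_stats_separated:
  assumes \<theta>: "\<theta> > 0" and link: "\<And>x. 1 - cdf \<nu> x = (1 - cdf \<mu> x) powr \<theta>"
    and s: "s < m" and r: "r < n" and i: "i < m - s" and k: "k < n - r"
  shows "prob {\<omega> \<in> space M. exceedance_stat m n X Y s \<omega> = k \<and> precedence_stat m n X Y r \<omega> = i}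
    = fact m * fact n * \<theta> / (fact r * fact s * fact (n - k - r - 1) * fact k)
        * S_p m n r (1 / \<theta>) i * S_z m n s r (1 / \<theta>) k i"
proof -
  let ?E = "{\<omega> \<in> space M. exceedance_stat m n X Y s \<omega> = k \<and> precedence_stat m n X Y r \<omega> = i}"
  define S where "S p = {\<omega> \<in> space M. separated_at m n i s r k (\<lambda>i. X i \<omega>) (\<lambda>j. Y j \<omega>) (fst p) (snd p)}" for p
  let ?K = "{1..m} \<times> {1..n}"
  obtain N where no_ties: "\<And>\<omega>. \<omega> \<in> space M - N \<Longrightarrow>
      inj_on (\<lambda>i. X i \<omega>) {1..m} \<and> inj_on (\<lambda>j. Y j \<omega>) {1..n} \<and>
      (\<forall>i\<in>{1..m}. \<forall>j\<in>{1..n}. X i \<omega> \<noteq> Y j \<omega>)"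
    and N: "N \<in> null_sets M"
    by (rule AE_E3[OF AE_no_ties]) (rule that)
  have S_ev: "S p \<in> events" if "p \<in> ?K" for p
    unfolding S_def using that by (intro emeasure_separated_at) auto
  have "?E - N = (\<Union>p\<in>?K. S p - N)"
  proof -
    have "\<omega> \<in> ?E \<longleftrightarrow> (\<exists>p\<in>?K. \<omega> \<in> S p)" if \<omega>: "\<omega> \<in> space M - N" for \<omega>
    proof -
      have "exceedance_stat m n X Y s \<omega> = k \<and> precedence_stat m n X Y r \<omega> = i \<longleftrightarrow>
          (\<exists>a\<in>{1..m}. \<exists>b\<in>{1..n}. separated_at m n i s r k (\<lambda>i. X i \<omega>) (\<lambda>j. Y j \<omega>) a b)"
        unfolding exceedance_stat_def precedence_stat_def
        using no_ties[OF \<omega>] by (intro stats_eq_iff_ex_separated_at s r i) blast+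
      then show ?thesis using \<omega> by (simp add: S_def)
    qed
    moreover have "S p \<subseteq> space M" "?E \<subseteq> space M" for p by (auto simp: S_def)
    ultimately show ?thesis by blast
  qed
  then have "prob (?E - N) = prob (\<Union>p\<in>?K. S p - N)" by simp
  also have "\<dots> = (\<Sum>p\<in>?K. prob (S p - N))"
  proof (intro finite_measure_finite_Union)
    show "disjoint_family_on (\<lambda>p. S p - N) ?K"
      unfolding disjoint_family_on_def
    proof (intro ballI impI)
      fix p q assume p: "p \<in> ?K" and q: "q \<in> ?K" and "p \<noteq> q"
      have False if "\<omega> \<in> S p - N" "\<omega> \<in> S q - N" for \<omega>
      proof -
        have "\<omega> \<in> space M - N" using that by (auto simp: S_def)
        then have "fst p = fst q \<and> snd p = snd q"
          using no_ties[of \<omega>] s r p q that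
          by (intro separated_at_unique[of "\<lambda>i. X i \<omega>" m "\<lambda>j. Y j \<omega>" n s r _ _ _ _ i k])
             (auto simp: S_def)
        then show False using \<open>p \<noteq> q\<close> by (simp add: prod_eq_iff)
      qed
      then show "(S p - N) \<inter> (S q - N) = {}" by blast
    qed
  qed (use S_ev N in auto)
  also have "\<dots> = (\<Sum>p\<in>?K. prob (S p))"
    using S_ev N by (intro sum.cong refl measure_Diff_null_set)
  finally have "prob ?E = (\<Sum>p\<in>?K. prob (S p))"
    using measure_Diff_null_set[OF stats_event[OF s r] N] by simp
  also have "\<dots> = (\<Sum>p\<in>?K. real (m - 1 choose i) * real (m - 1 - i choose s) *
       (real (n - 1 choose r) * real (n - 1 - r choose k))
        * (outer_value i (m - 1 - i - s) s r (n - 1 - r - k) k \<theta> * inner_value (m - 1 - i - s) s (n - 1 - r - k) k \<theta>))"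
    unfolding S_def by (intro sum.cong refl prob_separated_at \<theta> link) auto
  also have "\<dots> = (real m * (real (m - 1 choose i) * real (m - 1 - i choose s))) *
       (real n * (real (n - 1 choose r) * real (n - 1 - r choose k)))
        * (outer_value i (m - 1 - i - s) s r (n - 1 - r - k) k \<theta> * inner_value (m - 1 - i - s) s (n - 1 - r - k) k \<theta>)"
    by (simp add: mult_ac)
  also have "real m * (real (m - 1 choose i) * real (m - 1 - i choose s))
      = fact m / (fact i * fact s * fact (m - 1 - i - s))"
    using i s by (intro multinomial_count) auto
  also have "real n * (real (n - 1 choose r) * real (n - 1 - r choose k))
      = fact n / (fact r * fact k * fact (n - 1 - r - k))"
    using r k by (intro multinomial_count) auto
  also have "outer_value i (m - 1 - i - s) s r (n - 1 - r - k) k \<theta> * inner_value (m - 1 - i - s) s (n - 1 - r - k) k \<theta>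
     = (fact i * \<theta> * S_p m n r (1 / \<theta>) i) * (fact (m - 1 - i - s) * S_z m n s r (1 / \<theta>) k i)"
  proof -
    have 1: "s + (m - 1 - i - s) + 1 = m - i" "n - 1 - r - k + k + 1 + p = n - r + p" for p
      using s r i k by auto
    have 2: "real (m - i) + x + real i + 1 = real m + x + 1" for x
      using i by simp
    have 3: "real s + x + 1 + real (m - 1 - i - s) + 1 = real (m - i) + x + 1" for x
      using i s by (simp add: of_nat_diff)
    have 4: "n - 1 - r - k = n - k - r - 1" using r k by simp
    show ?thesis
      unfolding outer_value_def inner_value_def S_p_def S_z_def add.commute[of k "n - 1 - r - k"] 1 2 3 unfolding 4 by simp
  qed
  finally show ?thesis
    by (simp add: diff_commute[of n] field_simps)
qed

text \<open>
The order statistic \<open>X\<^sub>(\<^sub>m\<^sub>-\<^sub>s\<^sub>)\<close> is the \<open>(1 + r')\<close>-th smallest of its sample for \<open>r' = m - s - 1\<close>, and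
\<open>Y\<^sub>(\<^sub>1\<^sub>+\<^sub>r\<^sub>)\<close> is the \<open>(n - s')\<close>-th smallest for \<open>s' = n - r - 1\<close>. Hence these are the parameters of the
statistics after the exchange of the samples.
\<close>

lemma stats_complement:
  assumes s: "s < m" and r: "r < n"
  shows "AE \<omega> in M. exceedance_stat m n X Y s \<omega> + precedence_stat n m Y X (m - s - 1) \<omega> = n
    \<and> precedence_stat m n X Y r \<omega> + exceedance_stat n m Y X (n - r - 1) \<omega> = m"
  using AE_cross
proof eventually_elim
  case (elim \<omega>)
  let ?x = "order_stat m (\<lambda>i. X i \<omega>) (m - s)" and ?y = "order_stat n (\<lambda>j. Y j \<omega>) (1 + r)"
  obtain a where a: "a \<in> {1..m}" "?x = X a \<omega>"
    using order_stat_attained[of "m - s" m "\<lambda>i. X i \<omega>"] s by (auto simp: Suc_le_eq)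
  obtain b where b: "b \<in> {1..n}" "?y = Y b \<omega>"
    using order_stat_attained[of "1 + r" n "\<lambda>j. Y j \<omega>"] r by (auto simp: Suc_le_eq)
  have e: "1 + (m - s - 1) = m - s" "n - (n - r - 1) = 1 + r" using s r by auto
  have count: "card {j\<in>{1..N}. P j} + card {j\<in>{1..N}. Q j} = N"
    if "\<And>j. j \<in> {1..N} \<Longrightarrow> P j \<longleftrightarrow> \<not> Q j" for N :: nat and P Q
  proof -
    have "card {j\<in>{1..N}. P j} + card {j\<in>{1..N}. Q j} = card ({j\<in>{1..N}. P j} \<union> {j\<in>{1..N}. Q j})"
      using that by (intro card_Un_disjoint[symmetric]) auto
    also have "{j\<in>{1..N}. P j} \<union> {j\<in>{1..N}. Q j} = {1..N}" using that by blast
    finally show ?thesis by simp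
  qed
  have "?x < Y j \<omega> \<longleftrightarrow> \<not> Y j \<omega> < ?x" if "j \<in> {1..n}" for j
  proof -
    have "X a \<omega> \<noteq> Y j \<omega>" using elim a(1) that by blast
    then show ?thesis unfolding a(2) by linarith
  qed
  moreover have "X i \<omega> < ?y \<longleftrightarrow> \<not> ?y < X i \<omega>" if "i \<in> {1..m}" for i
  proof -
    have "X i \<omega> \<noteq> Y b \<omega>" using elim b(1) that by blast
    then show ?thesis unfolding b(2) by linarith
  qed
  ultimately show ?case
    unfolding exceedance_stat_def precedence_stat_def e by (intro conjI count)
qed

text \<open>
The exchange replaces \<open>(i, k)\<close> by \<open>(n - k, m - i)\<close>; under it \<open>S_p\<close> becomes \<open>S_z'\<close> and \<open>S_z\<close> becomes \<open>S_p'\<close>.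
\<close>

lemma prob_stats_crossed:
  assumes \<eta>: "\<eta> > 0" and link: "\<And>x. 1 - cdf \<mu> x = (1 - cdf \<nu> x) powr \<eta>"
    and s: "s < m" and r: "r < n" and i: "m - s \<le> i" "i \<le> m" and k: "n - r \<le> k" "k \<le> n"
  shows "prob {\<omega> \<in> space M. exceedance_stat m n X Y s \<omega> = k \<and> precedence_stat m n X Y r \<omega> = i}
    = fact m * fact n * \<eta> /
         (fact (n - r - 1) * fact (m - s - 1) * fact (i - (m - s)) * fact (m - i))
         * S_p' m n s r \<eta> k i * S_z' m n s \<eta> k"
proof -
  interpret swapped: two_continuous_samples M n m Y X \<nu> \<mu> by (rule swap)
  have s': "n - r - 1 < n" and r': "m - s - 1 < m" using s r by auto
  have "prob {\<omega> \<in> space M. exceedance_stat m n X Y s \<omega> = k \<and> precedence_stat m n X Y r \<omega> = i}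
      = prob {\<omega> \<in> space M. exceedance_stat n m Y X (n - r - 1) \<omega> = m - i
                \<and> precedence_stat n m Y X (m - s - 1) \<omega> = n - k}"
  proof (rule finite_measure_eq_AE[OF _ stats_event[OF s r] swapped.stats_event[OF s' r']])
    show "AE \<omega> in M. \<omega> \<in> {\<omega> \<in> space M. exceedance_stat m n X Y s \<omega> = k \<and> precedence_stat m n X Y r \<omega> = i}
      \<longleftrightarrow> \<omega> \<in> {\<omega> \<in> space M. exceedance_stat n m Y X (n - r - 1) \<omega> = m - i
                \<and> precedence_stat n m Y X (m - s - 1) \<omega> = n - k}"
      using stats_complement[OF s r]
    proof eventually_elim
      case (elim \<omega>)
      then have "exceedance_stat m n X Y s \<omega> = k \<longleftrightarrow> precedence_stat n m Y X (m - s - 1) \<omega> = n - k"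
        "precedence_stat m n X Y r \<omega> = i \<longleftrightarrow> exceedance_stat n m Y X (n - r - 1) \<omega> = m - i"
        using i k by linarith+
      then show ?case by auto
    qed
  qed
  also have "\<dots> = fact n * fact m * \<eta> / (fact (m - s - 1) * fact (n - r - 1) * fact (m - (m - i) - (m - s - 1) - 1) * fact (m - i))
        * S_p n m (m - s - 1) (1 / \<eta>) (n - k) * S_z n m (n - r - 1) (m - s - 1) (1 / \<eta>) (m - i) (n - k)"
    using s r i k by (intro swapped.prob_stats_separated \<eta> link) auto
  also have "m - (m - i) - (m - s - 1) - 1 = i - (m - s)" using i s by simp
  also have "S_p n m (m - s - 1) (1 / \<eta>) (n - k) = S_z' m n s \<eta> k"
  proof -
    have "n - (n - k) = k" "m - (m - s - 1) + p = p + s + 1" for p using s k by auto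
    then show ?thesis unfolding S_p_def S_z'_def by simp
  qed
  also have "S_z n m (n - r - 1) (m - s - 1) (1 / \<eta>) (m - i) (n - k) = S_p' m n s r \<eta> k i"
  proof -
    have 1: "m - (m - i) - (m - s - 1) - 1 = i - (m - s)" "n - (n - k) = k" using i s k by auto
    have 2: "real (n - r - 1) + x + 1 = real (n - r) + x" for x using r by (simp add: of_nat_diff)
    have 3: "z + (m - i) = m - i + z" for z by simp
    show ?thesis unfolding S_z_def S_p'_def 1 2 3 by simp
  qed
  finally show ?thesis by (simp add: mult_ac)
qed

end

section \<open>The joint law under the Lehmann alternative\<close>

text \<open>
\<open>F\<close> is the distribution function of the measure with the given density, and this measure has no atoms.
\<close>

lemma abs_cont_cdf_isCont:
  assumes "abs_cont_cdf F"
  shows "isCont F x"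
proof -
  obtain f where f: "integrable lborel f" "\<And>t. 0 \<le> f t" "(\<integral>t. f t \<partial>lborel) = 1"
    and F: "\<And>x. F x = (LINT t:{..x}|lborel. f t)"
    using assms unfolding abs_cont_cdf_def by blast
  note [measurable] = borel_measurable_integrable[OF f(1)]
  let ?D = "density lborel (\<lambda>t. ennreal (f t))"
  have D: "emeasure ?D A = ennreal (LINT t:A|lborel. f t)" if A: "A \<in> sets borel" for A
  proof -
    have "emeasure ?D A = (\<integral>\<^sup>+t. ennreal (indicator A t * f t) \<partial>lborel)"
      using A by (auto simp: emeasure_density intro!: nn_integral_cong split: split_indicator)
    also have "\<dots> = ennreal (\<integral>t. indicator A t * f t \<partial>lborel)"
      using f A by (intro nn_integral_eq_integral) (auto intro: integrable_real_mult_indicator simp: mult.commute[of "indicator _ _"])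
    finally show ?thesis by (simp add: set_lebesgue_integral_def)
  qed
  have "prob_space ?D"
    using D[of UNIV] f(3) by (intro prob_spaceI) (simp add: set_lebesgue_integral_def)
  then interpret D: real_distribution ?D
    by (intro real_distribution.intro real_distribution_axioms.intro) simp_all
  have "cdf ?D x = F x" for x
  proof -
    have "0 \<le> (LINT t:{..x}|lborel. f t)"
      unfolding set_lebesgue_integral_def using f(2) by (intro integral_nonneg_AE) simp
    then show ?thesis using D[of "{..x}"] by (simp add: cdf_def measure_def F)
  qed
  then have cdf_eq: "cdf ?D = F" by (rule ext)
  have "{x} \<in> null_sets lborel" by (simp add: null_sets_def)
  then have "emeasure ?D {x} = 0"
    by (subst emeasure_density) (simp_all add: nn_integral_null_set)
  then have "measure ?D {x} = 0" by (simp add: measure_def)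
  then have "isCont (cdf ?D) x" by (simp only: D.isCont_cdf)
  then show ?thesis unfolding cdf_eq .
qed

lemma two_continuous_samplesI:
  assumes M: "prob_space M" and "1 \<le> m" "1 \<le> n"
    and X: "iid_sample M m X F" and Y: "iid_sample M n Y G" and "indep_samples M m X n Y"
    and F: "\<And>x. isCont F x" and G: "\<And>x. isCont G x"
  obtains \<mu> \<nu> where "two_continuous_samples M m n X Y \<mu> \<nu>" "cdf \<mu> = F" "cdf \<nu> = G"
proof
  interpret prob_space M by fact
  have law: "distr M borel (Z i) = distr M borel (Z 1) \<and> cdf (distr M borel (Z 1)) = H"
    if Z: "iid_sample M N Z H" and i: "i \<in> {1..N}" for Z N H i
  proof -
    have rv: "random_variable borel (Z j)" if "j \<in> {1..N}" for j
      using Z that unfolding iid_sample_def indep_vars_def by blast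
    have cdf: "cdf (distr M borel (Z j)) = H" if "j \<in> {1..N}" for j
      using Z that unfolding iid_sample_def by blast
    have 1: "1 \<in> {1..N}" using i by simp
    have "distr M borel (Z i) = distr M borel (Z 1)"
      by (rule cdf_unique[OF real_distribution_distr[OF rv[OF i]] real_distribution_distr[OF rv[OF 1]]])
         (simp only: cdf[OF i] cdf[OF 1])
    then show ?thesis using cdf[OF 1] by (rule conjI)
  qed
  have 1: "1 \<in> {1..m}" "1 \<in> {1..n}" using assms(2,3) by simp_all
  show cdfs: "cdf (distr M borel (X 1)) = F" "cdf (distr M borel (Y 1)) = G"
    using law[OF X 1(1)] law[OF Y 1(2)] by blast+
  have "indep_vars (\<lambda>_. borel) X {1..m}" "indep_vars (\<lambda>_. borel) Y {1..n}"
    using X Y unfolding iid_sample_def by blast+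
  then show "two_continuous_samples M m n X Y (distr M borel (X 1)) (distr M borel (Y 1))"
    using law[OF X] law[OF Y] assms(2,3,6) F G
    by (intro two_continuous_samples.intro two_continuous_samples_axioms.intro prob_space_axioms)
       (blast | simp only: cdfs)+
qed

theorem theorem4p1:
  fixes M :: "'a measure"
    and X Y :: "nat \<Rightarrow> 'a \<Rightarrow> real"
    and F G :: "real \<Rightarrow> real"
    and m n s r :: nat
    and \<eta> :: real
  assumes "prob_space M"
    and "m \<ge> 1" and "n \<ge> 1"
    and "iid_sample M m X F" and "iid_sample M n Y G"
    and "indep_samples M m X n Y"
    and "abs_cont_cdf F" and "abs_cont_cdf G"
    and "\<eta> > 1" and "lehmann_alternative \<eta> F G"
    and "s < m" and "r < n"
  shows "\<forall>k i :: nat.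
    measure M {\<omega> \<in> space M. exceedance_stat m n X Y s \<omega> = k \<and> precedence_stat m n X Y r \<omega> = i} =
    (if i \<le> m - s - 1 \<and> k \<le> n - r - 1 then
       fact m * fact n * (1 / \<eta>) / (fact r * fact s * fact (n - k - r - 1) * fact k)
         * S_p m n r \<eta> i * S_z m n s r \<eta> k i
     else if m - s \<le> i \<and> i \<le> m \<and> n - r \<le> k \<and> k \<le> n then
       fact m * fact n * \<eta> /
         (fact (n - r - 1) * fact (m - s - 1) * fact (i - (m - s)) * fact (m - i))
         * S_p' m n s r \<eta> k i * S_z' m n s \<eta> k
     else 0)"
proof (intro allI)
  fix k i :: nat
  let ?E = "{\<omega> \<in> space M. exceedance_stat m n X Y s \<omega> = k \<and> precedence_stat m n X Y r \<omega> = i}"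
  obtain \<mu> \<nu> where samples: "two_continuous_samples M m n X Y \<mu> \<nu>" and F: "cdf \<mu> = F" and G: "cdf \<nu> = G"
    using two_continuous_samplesI[OF assms(1-6) abs_cont_cdf_isCont[OF assms(7)] abs_cont_cdf_isCont[OF assms(8)]]
    by blast
  interpret two_continuous_samples M m n X Y \<mu> \<nu> by (rule samples)
  have \<eta>: "\<eta> > 0" using assms(9) by simp
  have GF: "1 - cdf \<nu> x = (1 - cdf \<mu> x) powr (1 / \<eta>)" for x
    using assms(10) unfolding lehmann_alternative_def F G by simp
  have "cdf \<mu> x \<le> 1" for x
    using real_distribution.cdf_bounded_prob[OF real_distribution_laws(1)] by blast
  then have FG: "1 - cdf \<mu> x = (1 - cdf \<nu> x) powr \<eta>" for x
    using \<eta> by (simp add: GF powr_powr)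
  show "measure M ?E = (if i \<le> m - s - 1 \<and> k \<le> n - r - 1 then
       fact m * fact n * (1 / \<eta>) / (fact r * fact s * fact (n - k - r - 1) * fact k)
         * S_p m n r \<eta> i * S_z m n s r \<eta> k i
     else if m - s \<le> i \<and> i \<le> m \<and> n - r \<le> k \<and> k \<le> n then
       fact m * fact n * \<eta> /
         (fact (n - r - 1) * fact (m - s - 1) * fact (i - (m - s)) * fact (m - i))
         * S_p' m n s r \<eta> k i * S_z' m n s \<eta> k
     else 0)"
  proof (cases "i \<le> m - s - 1 \<and> k \<le> n - r - 1")
    case True
    then have "i < m - s" "k < n - r" using assms(11,12) by auto
    then have "measure M ?E = fact m * fact n * (1 / \<eta>) / (fact r * fact s * fact (n - k - r - 1) * fact k)
         * S_p m n r (1 / (1 / \<eta>)) i * S_z m n s r (1 / (1 / \<eta>)) k i"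
      using \<eta> by (intro prob_stats_separated GF assms(11,12)) auto
    then show ?thesis using True by simp
  next
    case not_separated: False
    show ?thesis
    proof (cases "m - s \<le> i \<and> i \<le> m \<and> n - r \<le> k \<and> k \<le> n")
      case True
      then have "measure M ?E = fact m * fact n * \<eta> /
         (fact (n - r - 1) * fact (m - s - 1) * fact (i - (m - s)) * fact (m - i))
         * S_p' m n s r \<eta> k i * S_z' m n s \<eta> k"
        by (intro prob_stats_crossed \<eta> FG assms(11,12)) auto
      then show ?thesis unfolding if_not_P[OF not_separated] if_P[OF True] .
    next
      case False
      have "?E = {}"
      proof (rule ccontr)
        assume "?E \<noteq> {}"
        then obtain \<omega> where k: "exceedance_stat m n X Y s \<omega> = k" and i: "precedence_stat m n X Y r \<omega> = i"
          by blast
        have card_le: "card {j\<in>{1..N}. P j} \<le> N" for N :: nat and P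
        proof -
          have "card {j\<in>{1..N}. P j} \<le> card {1..N}" by (rule card_mono) auto
          then show ?thesis by simp
        qed
        have "m - s \<le> i \<longleftrightarrow> n - r \<le> k"
          using order_stats_separated_iff[OF assms(11,12), of "\<lambda>i. X i \<omega>" "\<lambda>j. Y j \<omega>"]
          unfolding exceedance_stat_def[symmetric] precedence_stat_def[symmetric] k i by blast
        moreover have "i \<le> m" "k \<le> n"
          unfolding k[symmetric] i[symmetric] exceedance_stat_def precedence_stat_def by (rule card_le)+
        ultimately show False using False not_separated assms(11,12) by linarith
      qed
      then have "measure M ?E = 0" by (simp only: measure_empty)
      then show ?thesis unfolding if_not_P[OF not_separated] if_not_P[OF False] .
    qed
  qed
qed

end
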